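(* Let $S\subset\mathbb{R}^d$ be a compact, nonconvex and nonempty set satisfying condition $(R_\lambda^r)$ for some $r>0$ and $\lambda>0$, that is, $S$ fulfills the $r$-rolling condition and $S^c$ fulfills the $\lambda$-rolling condition. Let $X_1,X_2,\dots$ be i.i.d. random points with the uniform distribution on $S$, and let $\mathcal{X}_n=\{X_1,\dots,X_n\}$. Let $r_0=\sup\{\gamma>0: C_\gamma(S)=S\}$. Let $\{\alpha_n\}\subset(0,1)$ be a sequence converging to zero such that $\lim_{n\to\infty}\log(\alpha_n)/n=0$, and let $\hat r_0=\sup\{\gamma>0:\ \hat V_{n,\gamma}\le \hat c_{n,\alpha_n,\gamma}\}$. Then $\hat r_0$ converges to $r_0$ in probability as $n\to\infty$.
   Context: $B_r(x)$ and $B_r[x]$ denote the open and closed Euclidean balls in $\mathbb{R}^d$ with center $x$ and radius $r$; $\mu$ is Lebesgue measure on $\mathbb{R}^d$. A set $A\subset\mathbb{R}^d$ fulfills the (outside) $r$-rolling condition if each boundary point $a\in\partial A$ is contained in a closed ball of radius $r$ whose interior does not meet $A$. The $r$-convex hull of $A$ is $C_r(A)=\bigcap_{\{B_r(x):\,B_r(x)\cap A=\emptyset\}}(B_r(x))^c$; a closed set $A$ is $r$-convex if $A=C_r(A)$. Test quantities. For $\gamma>0$, let $\hat\Delta_{n,\gamma}=\sup\{\rho>0:\exists x \text{ with } B_\rho[x]\subset C_\gamma(\mathcal{X}_n)\setminus\mathcal{X}_n\}$ (with value $0$ if there is no such $\rho$), and let $\hat V_{n,\gamma}$ be the Lebesgue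 measure of a ball of radius $\hat\Delta_{n,\gamma}$. For $\alpha\in(0,1)$ let $u_\alpha=-\log(-\log(1-\alpha))$, the $(1-\alpha)$-quantile of a random variable $U$ with $\mathbb{P}(U\le u)=\exp(-\exp(-u))$, $u\in\mathbb{R}$. For $n\ge 2$ define $$\hat c_{n,\alpha,\gamma}=\frac{\mu(C_\gamma(\mathcal{X}_n))\left(u_\alpha+\log n+(d-1)\log\log n+\log\beta\right)}{n},$$ where $\beta$ is Janson's constant $\beta=\frac{1}{d!}\left(\frac{\sqrt{\pi}\,\Gamma(d/2+1)}{\Gamma((d+1)/2)}\right)^{d-1}$ (so $\beta=1$ for $d=2$). The uniformity hypothesis $H_0$ on $C_\gamma(\mathcal{X}_n)$ is rejected at level $\alpha$ if $\hat V_{n,\gamma}>\hat c_{n,\alpha,\gamma}$ and accepted otherwise. The estimator $\hat r_0$ takes values in $[0,+\infty]$ (supremum of the empty set being $0$, and the supremum of an unbounded set $+\infty$). *)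

theory Defs
  imports "HOL-Probability.Probability"
begin

definition rolling :: "real \<Rightarrow> 'a::euclidean_space set \<Rightarrow> bool" where
  "rolling r A \<longleftrightarrow> (\<forall>a\<in>frontier A. \<exists>x. a \<in> cball x r \<and> interior (cball x r) \<inter> A = {})"

definition rhull :: "real \<Rightarrow> 'a::euclidean_space set \<Rightarrow> 'a set" where
  "rhull r A = \<Inter>{- ball x r | x. ball x r \<inter> A = {}}"

text \<open>Supremum in \<open>[0, \<infinity>]\<close> of a set of positive reals. Inserting \<open>0\<close> only matters for the empty
  set, whose supremum in \<^typ>\<open>ereal\<close> would otherwise be \<open>-\<infinity>\<close>.\<close>

definition sup_nonneg :: "real set \<Rightarrow> ereal" where
  "sup_nonneg A = (SUP x\<in>insert 0 A. ereal x)"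

definition r_zero :: "'a::euclidean_space set \<Rightarrow> ereal" where
  "r_zero S = sup_nonneg {\<gamma>. 0 < \<gamma> \<and> rhull \<gamma> S = S}"

text \<open>In the following definitions \<open>P\<close> is the realised sample, a finite set. Then
  \<^term>\<open>rhull \<gamma> P\<close> lies in the convex hull of \<open>P\<close>, so the set of radii in \<open>Delta_hat\<close> is bounded and
  its real supremum is meaningful; the empty case is treated separately.\<close>

definition Delta_hat :: "real \<Rightarrow> 'a::euclidean_space set \<Rightarrow> real" where
  "Delta_hat \<gamma> P =
     (let R = {\<rho>. 0 < \<rho> \<and> (\<exists>x. cball x \<rho> \<subseteq> rhull \<gamma> P - P)}
      in if R = {} then 0 else Sup R)"

definition V_hat :: "real \<Rightarrow> 'a::euclidean_space set \<Rightarrow> real" where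
  "V_hat \<gamma> P = measure lborel (ball (0::'a) (Delta_hat \<gamma> P))"

definition janson_const :: "nat \<Rightarrow> real" where
  "janson_const d =
     1 / fact d * (sqrt pi * Gamma (real d / 2 + 1) / Gamma ((real d + 1) / 2)) ^ (d - 1)"

definition gumbel_quantile :: "real \<Rightarrow> real" where
  "gumbel_quantile \<alpha> = - ln (- ln (1 - \<alpha>))"

text \<open>The sample size \<open>n\<close> is a separate argument, since sample points may coincide. The values for
  \<open>n < 2\<close>, where \<open>ln (ln n)\<close> is not meaningful, are irrelevant for limits in \<open>n\<close>.\<close>

definition c_hat :: "nat \<Rightarrow> real \<Rightarrow> real \<Rightarrow> 'a::euclidean_space set \<Rightarrow> real" where
  "c_hat n \<alpha> \<gamma> P =
     measure lborel (rhull \<gamma> P) *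
       (gumbel_quantile \<alpha> + ln (real n) + (real DIM('a) - 1) * ln (ln (real n))
          + ln (janson_const DIM('a))) / real n"

definition r_zero_hat :: "nat \<Rightarrow> real \<Rightarrow> 'a::euclidean_space set \<Rightarrow> ereal" where
  "r_zero_hat n \<alpha> P = sup_nonneg {\<gamma>. 0 < \<gamma> \<and> V_hat \<gamma> P \<le> c_hat n \<alpha> \<gamma> P}"

text \<open>The outer measure agrees with the probability on events. It is used because
  \<^const>\<open>emeasure\<close> is \<open>0\<close> on non-measurable sets, which would make the condition vacuous if some
  \<open>Y n\<close> were not measurable. An infinite value of \<open>Y n\<close> counts as a deviation from a finite limit.\<close>

definition converges_in_probability ::
    "'w measure \<Rightarrow> (nat \<Rightarrow> 'w \<Rightarrow> ereal) \<Rightarrow> ereal \<Rightarrow> bool" where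
  "converges_in_probability M Y c \<longleftrightarrow>
     (\<forall>\<epsilon>>0. (\<lambda>n. outer_measure_of M {\<omega>\<in>space M. ereal \<epsilon> < \<bar>Y n \<omega> - c\<bar>}) \<longlonglongrightarrow> 0)"

end

theory Submission
  imports Defs "HOL-Real_Asymp.Real_Asymp"
begin

text \<open>
  If \<open>\<gamma> > r\<^sub>0\<close>, some point outside \<open>S\<close> is interior to the \<open>\<gamma>\<close>-convex hull of \<open>S\<close>, and a fixed ball
  around it lies in the \<open>\<gamma>\<close>-convex hull of every sufficiently dense sample: the volume statistic stays
  bounded away from \<open>0\<close> while the critical value tends to \<open>0\<close>, simultaneously for all larger radii.

  If \<open>C\<^sub>\<gamma>(S) = S\<close>, the statistic is at most the maximal spacing in \<open>S\<close>. As \<open>u\<^bsub>\<alpha>\<^esub>\<close> tends to infinity,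
  only the upper tail in Janson's theorem is needed, and a union bound over a net gives it. The hull
  of the sample contains the inner parallel set of \<open>S\<close> at a distance \<open>\<eta>\<close> that is a negative power
  of \<open>n\<close>; the rolling condition bounds the remaining volume by \<open>C \<eta>\<close>, so replacing \<open>\<mu>(S)\<close> by the
  volume of the hull shifts the centred critical value by an amount negligible against \<open>u\<^bsub>\<alpha>\<^esub>\<close>.
\<close>

section \<open>The r-convex hull\<close>

lemma mem_rhull_iff: "x \<in> rhull \<gamma> A \<longleftrightarrow> (\<forall>c. dist c x < \<gamma> \<longrightarrow> (\<exists>a\<in>A. dist c a < \<gamma>))"
proof -
  have "x \<in> rhull \<gamma> A \<longleftrightarrow> (\<forall>c. ball c \<gamma> \<inter> A = {} \<longrightarrow> x \<notin> ball c \<gamma>)"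
    unfolding rhull_def by blast
  then show ?thesis by (auto simp: disjoint_iff)
qed

lemma subset_rhull: "A \<subseteq> rhull \<gamma> A"
  by (auto simp: mem_rhull_iff)

lemma closed_rhull: "closed (rhull \<gamma> A)"
  unfolding rhull_def by (intro closed_Inter) auto

lemma rhull_mono: "A \<subseteq> B \<Longrightarrow> rhull \<gamma> A \<subseteq> rhull \<gamma> B"
  by (force simp: mem_rhull_iff)

lemma point_towards:
  fixes x c :: "'a::real_normed_vector"
  assumes "0 \<le> t" "t \<le> 1"
  shows "dist (x + t *\<^sub>R (c - x)) x = t * dist c x" "dist c (x + t *\<^sub>R (c - x)) = (1 - t) * dist c x"
proof -
  show "dist (x + t *\<^sub>R (c - x)) x = t * dist c x"
    using assms by (simp add: dist_norm)
  have "c - (x + t *\<^sub>R (c - x)) = (1 - t) *\<^sub>R (c - x)"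
    by (simp add: algebra_simps)
  then show "dist c (x + t *\<^sub>R (c - x)) = (1 - t) * dist c x"
    using assms by (simp only: dist_norm norm_scaleR)
qed

text \<open>A \<open>\<gamma>'\<close>-ball containing \<open>x\<close>, shrunk towards
  \<open>x\<close> by the factor \<open>\<gamma> / \<gamma>'\<close>, becomes a
  \<open>\<gamma>\<close>-ball that still contains \<open>x\<close> and lies in the original
  one.\<close>

lemma rhull_radius_mono:
  assumes "0 < \<gamma>" "\<gamma> \<le> \<gamma>'"
  shows "rhull \<gamma> A \<subseteq> rhull \<gamma>' A"
proof
  fix x assume x: "x \<in> rhull \<gamma> A"
  show "x \<in> rhull \<gamma>' A"
    unfolding mem_rhull_iff
  proof safe
    fix c assume c: "dist c x < \<gamma>'"
    define c' where "c' = x + (\<gamma> / \<gamma>') *\<^sub>R (c - x)"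
    have t: "0 \<le> \<gamma> / \<gamma>'" "\<gamma> / \<gamma>' \<le> 1" using assms by auto
    have "dist c' x < \<gamma>"
      unfolding c'_def point_towards(1)[OF t] using c assms by (simp add: field_simps)
    then obtain a where a: "a \<in> A" "dist c' a < \<gamma>"
      using x by (auto simp: mem_rhull_iff)
    have "dist c c' \<le> (1 - \<gamma> / \<gamma>') * \<gamma>'"
      unfolding c'_def point_towards(2)[OF t] using c t by (intro mult_left_mono) auto
    also have "\<dots> = \<gamma>' - \<gamma>" using assms by (simp add: field_simps)
    finally have "dist c a < \<gamma>'"
      using a(2) dist_triangle[of c a c'] by linarith
    then show "\<exists>a\<in>A. dist c a < \<gamma>'" using a by blast
  qed
qed

lemma rhull_subset_cball:
  fixes A :: "'a::euclidean_space set"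
  assumes "A \<subseteq> cball 0 R" "0 < \<gamma>" "0 \<le> R"
  shows "rhull \<gamma> A \<subseteq> cball 0 R"
proof
  fix x assume x: "x \<in> rhull \<gamma> A"
  show "x \<in> cball 0 R"
  proof (rule ccontr)
    assume "x \<notin> cball 0 R"
    then have R: "R < norm x" by simp
    \<comment> \<open>The ball around \<open>c\<close> contains \<open>x\<close> and misses
      \<open>cball 0 R\<close>: \<open>x\<close> is pushed radially out to norm
      \<open>R + \<gamma>\<close> unless it is already that far.\<close>
    obtain c where c: "dist c x < \<gamma>" "R + \<gamma> \<le> norm c"
    proof (cases "R + \<gamma> \<le> norm x")
      case True
      then show ?thesis using that[of x] assms by simp
    next
      case False
      define c where "c = ((R + \<gamma>) / norm x) *\<^sub>R x"
      have "x \<noteq> 0" using R assms(3) by auto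
      have "c - x = ((R + \<gamma> - norm x) / norm x) *\<^sub>R x"
        using \<open>x \<noteq> 0\<close> by (simp add: c_def diff_divide_distrib scaleR_left_diff_distrib)
      then have "dist c x = R + \<gamma> - norm x"
        using False \<open>x \<noteq> 0\<close> by (simp add: dist_norm)
      moreover have "norm c = R + \<gamma>" using \<open>x \<noteq> 0\<close> assms by (simp add: c_def)
      ultimately show ?thesis using that[of c] R by simp
    qed
    then obtain a where a: "a \<in> A" "dist c a < \<gamma>"
      using x by (auto simp: mem_rhull_iff)
    have "norm a \<le> R" using a(1) assms(1) by auto
    then show False
      using a(2) c(2) norm_triangle_ineq2[of c a] by (simp add: dist_norm)
  qed
qed

text \<open>\<open>K\<close> holds the centres of the \<open>\<gamma>'\<close>-balls missing
  \<open>S\<close>; it suffices that \<open>x\<close> is farther than \<open>\<gamma>'\<close> from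
  \<open>K\<close>. At distance exactly \<open>\<gamma>'\<close>, the closed
  \<open>\<gamma>\<close>-ball internally tangent at \<open>x\<close> to the nearest such ball would
  miss \<open>S\<close>, and a slight shift of it would give a \<open>\<gamma>\<close>-ball around
  \<open>x\<close> missing \<open>S\<close>.\<close>

lemma rhull_interior:
  fixes S :: "'a::euclidean_space set"
  assumes "closed S" and x: "x \<in> rhull \<gamma> S" "x \<notin> S" and \<gamma>: "0 < \<gamma>" "\<gamma> < \<gamma>'"
  shows "x \<in> interior (rhull \<gamma>' S)"
proof -
  define K where "K = {c. ball c \<gamma>' \<inter> S = {}}"
  have K_eq: "K = (\<Inter>a\<in>S. - ball a \<gamma>')"
    by (auto simp: K_def disjoint_iff dist_commute)
  have "closed K" unfolding K_eq by (intro closed_INT) auto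
  show ?thesis
  proof (cases "K = {}")
    case True
    then have "rhull \<gamma>' S = UNIV"
      by (auto simp: rhull_def K_def)
    then show ?thesis by simp
  next
    case False
    then obtain c where c: "c \<in> K" and cmin: "\<And>y. y \<in> K \<Longrightarrow> dist x c \<le> dist x y"
      using distance_attains_inf[OF \<open>closed K\<close>, of x] by blast
    have x': "x \<in> rhull \<gamma>' S"
      using rhull_radius_mono[of \<gamma> \<gamma>' S] x(1) \<gamma> by auto
    have far: "\<gamma>' \<le> dist c a" if "a \<in> S" for a
      using c that by (auto simp: K_def disjoint_iff not_less)
    have ge: "\<gamma>' \<le> dist x c"
      using x' far by (force simp: mem_rhull_iff dist_commute not_less[symmetric])
    have "dist x c \<noteq> \<gamma>'"
    proof
      assume eq: "dist x c = \<gamma>'"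
      define t where "t = \<gamma> / \<gamma>'"
      have t: "0 < t" "t < 1" "t * \<gamma>' = \<gamma>" using \<gamma> by (auto simp: t_def)
      define c' where "c' = x + t *\<^sub>R (c - x)"
      have disj: "cball c' \<gamma> \<inter> S = {}"
      proof (rule ccontr)
        assume "cball c' \<gamma> \<inter> S \<noteq> {}"
        then obtain p where p: "p \<in> S" "dist c' p \<le> \<gamma>" by auto
        \<comment> \<open>With \<open>x\<close> as origin, lying outside the large ball gives
          \<open>q \<bullet> q \<ge> 2 * (q \<bullet> v)\<close> and lying in the small one
          \<open>q \<bullet> q \<le> 2 * (t * (q \<bullet> v))\<close>; as \<open>t < 1\<close>,
          only the contact point \<open>q = 0\<close> remains.\<close>
        define q v where "q = p - x" and "v = c - x"
        have v: "v \<bullet> v = \<gamma>' * \<gamma>'"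
          using eq by (metis v_def dist_commute dist_norm norm_eq_sqrt_inner power2_eq_square power2_norm_eq_inner)
        have "norm (q - v) \<ge> \<gamma>'"
          using far[OF p(1)] by (simp add: q_def v_def dist_norm norm_minus_commute)
        then have "(norm (q - v))\<^sup>2 \<ge> \<gamma>'\<^sup>2" using \<gamma> by (intro power_mono) auto
        then have 1: "q \<bullet> q \<ge> 2 * (q \<bullet> v)"
          using v by (simp add: power2_norm_eq_inner inner_diff_left inner_diff_right inner_commute power2_eq_square[of \<gamma>'])
        have "q - t *\<^sub>R v = p - c'" by (simp add: q_def v_def c'_def)
        then have "norm (q - t *\<^sub>R v) \<le> \<gamma>" using p(2) by (simp add: dist_norm norm_minus_commute)
        then have "(norm (q - t *\<^sub>R v))\<^sup>2 \<le> \<gamma>\<^sup>2" by (intro power_mono) auto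
        moreover have "(norm (q - t *\<^sub>R v))\<^sup>2 = q \<bullet> q - 2 * (t * (q \<bullet> v)) + t * t * (v \<bullet> v)"
          by (simp add: power2_norm_eq_inner algebra_simps inner_commute)
        moreover have "t * t * (v \<bullet> v) = \<gamma>\<^sup>2"
          unfolding v t(3)[symmetric] by (simp add: power2_eq_square)
        ultimately have 2: "q \<bullet> q \<le> 2 * (t * (q \<bullet> v))" by linarith
        have "0 \<le> t * (q \<bullet> v)" using 2 inner_ge_zero[of q] by linarith
        then have "0 \<le> q \<bullet> v" using t by (simp add: zero_le_mult_iff)
        moreover have "(1 - t) * (q \<bullet> v) \<le> 0" using 1 2 by (simp add: algebra_simps)
        ultimately have "q \<bullet> v = 0" using t by (simp add: mult_le_0_iff)
        with 2 have "q \<bullet> q \<le> 0" by simp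
        then have "q = 0" by (metis inner_ge_zero inner_eq_zero_iff antisym)
        then show False using p(1) x(2) by (simp add: q_def)
      qed
      obtain e where e: "e > 0" "\<And>y z. y \<in> cball c' \<gamma> \<Longrightarrow> z \<in> S \<Longrightarrow> e \<le> dist y z"
        using separate_compact_closed[OF compact_cball \<open>closed S\<close> disj] by blast
      \<comment> \<open>The shift has length \<open>s * \<gamma> < e\<close>, too short to reach
        \<open>S\<close>, yet it brings \<open>x\<close> strictly inside the ball.\<close>
      define s where "s = min (1/2) (e / (2 * \<gamma>))"
      have s: "0 < s" "s < 1" "s * \<gamma> < e"
        using e(1) \<gamma> by (auto simp: s_def min_def field_simps)
      define c'' where "c'' = c' + s *\<^sub>R (x - c')"
      have dc': "dist x c' = \<gamma>"
        using point_towards(1)[of t x c] t eq by (simp add: c'_def dist_commute)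
      have "dist c'' x = (1 - s) * \<gamma>"
        using point_towards(2)[of s x c'] s dc' by (simp add: c''_def dist_commute)
      then have "dist c'' x < \<gamma>" using mult_pos_pos[OF s(1) \<gamma>(1)] by (simp add: left_diff_distrib)
      then obtain a where a: "a \<in> S" "dist c'' a < \<gamma>"
        using x(1) by (auto simp: mem_rhull_iff)
      have "a + (c' - c'') \<in> cball c' \<gamma>"
        using a(2) by (simp add: dist_norm algebra_simps)
      then have "e \<le> dist (a + (c' - c'')) a" using a(1) by (rule e(2))
      also have "\<dots> = norm (c' - c'')" by (simp add: dist_norm)
      also have "\<dots> = s * \<gamma>"
        using point_towards(1)[of s c' x] s dc' by (simp add: c''_def dist_norm norm_minus_commute)
      finally show False using s by simp
    qed
    then have pos: "dist x c - \<gamma>' > 0" using ge by simp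
    have "ball x (dist x c - \<gamma>') \<subseteq> rhull \<gamma>' S"
    proof
      fix y assume y: "y \<in> ball x (dist x c - \<gamma>')"
      show "y \<in> rhull \<gamma>' S"
        unfolding mem_rhull_iff
      proof safe
        fix k assume k: "dist k y < \<gamma>'"
        show "\<exists>a\<in>S. dist k a < \<gamma>'"
        proof (rule ccontr)
          assume "\<not> ?thesis"
          then have "k \<in> K" by (auto simp: K_def)
          then have "dist x c \<le> dist x k" by (rule cmin)
          then show False using k y dist_triangle[of x k y] by (simp add: dist_commute)
        qed
      qed
    qed
    then show ?thesis using pos by (meson centre_in_ball interior_maximal open_ball subsetD)
  qed
qed

text \<open>Since \<open>x\<close> is interior to the hull of \<open>S\<close> for a radius below \<open>\<gamma>'\<close>, every ball of radius \<open>\<gamma>'\<close>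
  near \<open>x\<close> contains a ball of fixed size centred in \<open>S\<close>.\<close>

lemma rhull_stable:
  fixes S :: "'a::euclidean_space set"
  assumes "closed S" and x: "x \<in> rhull \<gamma> S" "x \<notin> S" and \<gamma>: "0 < \<gamma>" "\<gamma> < \<gamma>'"
  obtains \<rho> \<delta> where "\<rho> > 0" "\<delta> > 0" "cball x \<rho> \<inter> S = {}"
    "\<And>P. (\<And>s. s \<in> S \<Longrightarrow> ball s \<delta> \<inter> P \<noteq> {}) \<Longrightarrow> cball x \<rho> \<subseteq> rhull \<gamma>' P"
proof -
  define \<gamma>1 where "\<gamma>1 = (\<gamma> + \<gamma>') / 2"
  have \<gamma>1: "\<gamma> < \<gamma>1" "\<gamma>1 < \<gamma>'" using \<gamma> by (auto simp: \<gamma>1_def)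
  have "x \<in> interior (rhull \<gamma>1 S) \<inter> - S"
    using rhull_interior[OF assms(1-4) \<gamma>1(1)] x by auto
  moreover have "open (interior (rhull \<gamma>1 S) \<inter> - S)"
    using assms(1) by auto
  ultimately obtain e where e: "e > 0" "cball x e \<subseteq> interior (rhull \<gamma>1 S) \<inter> - S"
    unfolding open_contains_cball by meson
  \<comment> \<open>\<open>e / 2\<close> keeps the shifted point \<open>p'\<close> in
    \<open>cball x e\<close>; \<open>\<gamma>' - \<gamma>1\<close> keeps the reduced radius
    \<open>\<gamma>' - \<delta>\<close> at least \<open>\<gamma>1\<close>.\<close>
  define \<delta> where "\<delta> = min (e / 2) (\<gamma>' - \<gamma>1)"
  have \<delta>: "0 < \<delta>" "\<delta> \<le> e / 2" "\<gamma>1 \<le> \<gamma>' - \<delta>" "\<delta> < \<gamma>'"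
    using e \<gamma>1 \<gamma> by (auto simp: \<delta>_def min_def)
  have hull: "cball x e \<subseteq> rhull (\<gamma>' - \<delta>) S"
    using e(2) interior_subset[of "rhull \<gamma>1 S"] rhull_radius_mono[of \<gamma>1 "\<gamma>' - \<delta>" S] \<delta> \<gamma> \<gamma>1 by auto
  show ?thesis
  proof (rule that[of "e / 2" \<delta>])
    show "cball x (e / 2) \<inter> S = {}" using e by (auto simp: subset_iff disjoint_iff)
    fix P assume P: "\<And>s. s \<in> S \<Longrightarrow> ball s \<delta> \<inter> P \<noteq> {}"
    show "cball x (e / 2) \<subseteq> rhull \<gamma>' P"
    proof
      fix p assume p: "p \<in> cball x (e / 2)"
      show "p \<in> rhull \<gamma>' P"
        unfolding mem_rhull_iff
      proof safe
        fix c assume c: "dist c p < \<gamma>'"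
        \<comment> \<open>Moving \<open>p\<close> towards \<open>c\<close> by less than
          \<open>\<delta>\<close> places it in the ball of radius
          \<open>\<gamma>' - \<delta>\<close> around \<open>c\<close>, which therefore meets
          \<open>S\<close>; the lost \<open>\<delta>\<close> pays for passing from \<open>S\<close>
          to \<open>P\<close>.\<close>
        define t where "t = \<delta> / \<gamma>'"
        have t: "0 < t" "t < 1" "t * \<gamma>' = \<delta>" using \<delta> \<gamma> by (auto simp: t_def)
        define p' where "p' = p + t *\<^sub>R (c - p)"
        have "dist p' p = t * dist c p" "dist c p' = (1 - t) * dist c p"
          unfolding p'_def by (rule point_towards; use t in simp)+
        moreover have "t * dist c p < t * \<gamma>'" "(1 - t) * dist c p < (1 - t) * \<gamma>'"
          using c t by (auto intro!: mult_strict_left_mono)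
        ultimately have "dist p' p < \<delta>" "dist c p' < \<gamma>' - \<delta>"
          using t(3) by (auto simp: algebra_simps)
        moreover have "p' \<in> cball x e"
          using p \<open>dist p' p < \<delta>\<close> \<delta> dist_triangle[of x p' p] by (simp add: dist_commute)
        ultimately obtain s where s: "s \<in> S" "dist c s < \<gamma>' - \<delta>"
          using hull by (auto simp: mem_rhull_iff subset_iff)
        obtain a where "a \<in> P" "dist s a < \<delta>" using P[OF s(1)] by auto
        then show "\<exists>a\<in>P. dist c a < \<gamma>'"
          using s(2) dist_triangle[of c a s] by (intro bexI[of _ a]) auto
      qed
    qed
  qed (use e \<delta> in auto)
qed

text \<open>This makes \<open>r_zero\<close> finite. Some \<open>x\<close> outside \<open>S\<close>
  has a ball of radius \<open>e\<close> around it in the convex hull. If a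
  \<open>\<gamma>\<close>-ball around \<open>c\<close> contains \<open>x\<close> and misses
  \<open>S\<close>, then \<open>S\<close> lies in a half-space with normal \<open>c - x\<close>; the
  ball in the convex hull then forces \<open>c\<close> within \<open>D\<^sup>2 / e\<close> of
  \<open>x\<close>, too close to \<open>S\<close> for large \<open>\<gamma>\<close>.\<close>

lemma rhull_large_radius:
  fixes S :: "'a::euclidean_space set"
  assumes S: "compact S" "interior S \<noteq> {}" "\<not> convex S"
  obtains \<gamma>0 where "\<gamma>0 > 0" "\<And>\<gamma>. \<gamma> \<ge> \<gamma>0 \<Longrightarrow> rhull \<gamma> S \<noteq> S"
proof -
  let ?H = "convex hull S"
  \<comment> \<open>Otherwise closures would give \<open>convex hull S = S\<close>, as a convex set
    with nonempty interior lies in the closure of that interior.\<close>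
  have "\<not> interior ?H \<subseteq> S"
  proof
    assume "interior ?H \<subseteq> S"
    then have "closure (interior ?H) \<subseteq> S"
      using S(1) by (simp add: closure_minimal compact_imp_closed)
    moreover have "interior ?H \<noteq> {}"
      using S(2) interior_mono[OF hull_subset[of S convex]] by auto
    ultimately have "closure ?H \<subseteq> S"
      by (simp add: convex_closure_interior)
    then have "?H = S" using closure_subset[of ?H] hull_subset[of S convex] by auto
    then show False using S(3) convex_convex_hull[of S] by simp
  qed
  then obtain x e where x: "x \<notin> S" and e: "e > 0" "cball x e \<subseteq> ?H"
    by (meson mem_interior_cball subsetI)
  obtain D where D: "D > 0" "\<And>a. a \<in> S \<Longrightarrow> norm (a - x) \<le> D"
  proof -
    have "bounded ((\<lambda>a. a - x) ` S)"
      using S(1) by (simp add: bounded_translation_minus compact_imp_bounded)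
    then show ?thesis using that unfolding bounded_pos by auto
  qed
  define \<gamma>0 where "\<gamma>0 = D + D\<^sup>2 / e + 1"
  have pos: "D\<^sup>2 / e \<ge> 0" using e by simp
  show ?thesis
  proof (rule that[of \<gamma>0])
    show "\<gamma>0 > 0" using D pos by (simp add: \<gamma>0_def)
    fix \<gamma> assume \<gamma>: "\<gamma>0 \<le> \<gamma>"
    show "rhull \<gamma> S \<noteq> S"
    proof
      assume "rhull \<gamma> S = S"
      then obtain c where c: "dist c x < \<gamma>" "\<And>a. a \<in> S \<Longrightarrow> \<gamma> \<le> dist c a"
        using x mem_rhull_iff[of x \<gamma> S] by (metis not_less)
      define v where "v = c - x"
      \<comment> \<open>No point \<open>a\<close> of \<open>S\<close> is closer to \<open>c\<close>
        than \<open>x\<close> is; expanding the squared distances cancels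
        \<open>norm v\<close>.\<close>
      have half: "v \<bullet> a \<le> v \<bullet> x + D\<^sup>2 / 2" if "a \<in> S" for a
      proof -
        have "(norm v)\<^sup>2 \<le> \<gamma>\<^sup>2"
          using c(1) by (intro power_mono) (auto simp: v_def dist_norm)
        also have "\<gamma>\<^sup>2 \<le> (norm ((a - x) - v))\<^sup>2"
          using c(2)[OF that] \<gamma> \<open>\<gamma>0 > 0\<close>
          by (intro power_mono) (auto simp: v_def dist_norm norm_minus_commute)
        also have "\<dots> = (norm (a - x))\<^sup>2 - 2 * (v \<bullet> (a - x)) + (norm v)\<^sup>2"
          by (simp add: power2_norm_eq_inner algebra_simps inner_commute)
        finally have "2 * (v \<bullet> (a - x)) \<le> (norm (a - x))\<^sup>2" by simp
        also have "\<dots> \<le> D\<^sup>2" using D(2)[OF that] by (intro power_mono) auto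
        finally show ?thesis by (simp add: inner_diff_right)
      qed
      have nv: "norm v \<le> D\<^sup>2 / e"
      proof (cases "v = 0")
        case False
        \<comment> \<open>The point of \<open>cball x e\<close> farthest in direction
          \<open>v\<close> has to satisfy the half-space bound as well.\<close>
        define q where "q = x + (e / norm v) *\<^sub>R v"
        have "q \<in> ?H" using e False by (auto simp: q_def dist_norm)
        also have "?H \<subseteq> {y. v \<bullet> y \<le> v \<bullet> x + D\<^sup>2 / 2}"
          using half by (intro hull_minimal convex_halfspace_le) auto
        finally have "e / norm v * (v \<bullet> v) \<le> D\<^sup>2 / 2" by (simp add: q_def inner_add_right)
        moreover have "e / norm v * (v \<bullet> v) = e * norm v"
          using False by (simp add: dot_square_norm power2_eq_square)
        ultimately have "e * norm v \<le> D\<^sup>2"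
          using zero_le_power2[of D] by linarith
        then show ?thesis using e by (simp add: field_simps)
      qed (use pos in simp)
      obtain a where a: "a \<in> S" using S(2) interior_subset by blast
      have "dist c a \<le> norm v + norm (a - x)"
        using dist_triangle[of c a x] by (simp add: v_def dist_norm norm_minus_commute)
      then show False using c(2)[OF a] D(2)[OF a] nv \<gamma> by (simp add: \<gamma>0_def)
    qed
  qed
qed

text \<open>The centre is \<open>c\<close> if it is within \<open>\<eta> / 2\<close> of
  \<open>x\<close>, and otherwise the point at distance \<open>\<eta> / 2\<close> from
  \<open>x\<close> towards \<open>c\<close>. The non-strict bound on \<open>dist c x\<close> admits
  the contact points of rolling balls.\<close>

lemma cball_in_balls:
  fixes x c :: "'a::euclidean_space"
  assumes "0 < \<eta>" "\<eta> \<le> \<gamma>" "dist c x \<le> \<gamma>"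
  obtains q where "cball q (\<eta> / 4) \<subseteq> ball x \<eta> \<inter> ball c \<gamma>"
proof (cases "dist c x \<le> \<eta> / 2")
  case True
  have "cball c (\<eta> / 4) \<subseteq> ball x \<eta> \<inter> ball c \<gamma>"
  proof
    fix p assume "p \<in> cball c (\<eta> / 4)"
    then show "p \<in> ball x \<eta> \<inter> ball c \<gamma>"
      using True assms dist_triangle[of x p c] by (auto simp: dist_commute)
  qed
  then show ?thesis by (rule that)
next
  case False
  define t where "t = \<eta> / (2 * dist c x)"
  have pos: "0 < dist c x" using False assms(1) by linarith
  have t: "0 \<le> t" "t \<le> 1" "t * dist c x = \<eta> / 2"
    using False assms pos by (auto simp: t_def field_simps)
  define q where "q = x + t *\<^sub>R (c - x)"
  have q: "dist q x = \<eta> / 2" "dist c q = dist c x - \<eta> / 2"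
    unfolding q_def point_towards[OF t(1,2)] using t(3) by (auto simp: left_diff_distrib)
  have "cball q (\<eta> / 4) \<subseteq> ball x \<eta> \<inter> ball c \<gamma>"
  proof
    fix p assume "p \<in> cball q (\<eta> / 4)"
    then show "p \<in> ball x \<eta> \<inter> ball c \<gamma>"
      using q assms dist_triangle[of x p q] dist_triangle[of c p q] by (auto simp: dist_commute)
  qed
  then show ?thesis by (rule that)
qed

section \<open>Balls inside \<open>S\<close> and the density of the sample\<close>

lemma frontier_near:
  fixes S :: "'a::euclidean_space set"
  assumes "x \<in> S" "\<not> ball x \<eta> \<subseteq> S"
  obtains a where "a \<in> frontier S" "dist x a < \<eta>"
proof -
  have "0 < \<eta>" using assms by (metis ball_eq_empty empty_subsetI not_le)
  then have "x \<in> ball x \<eta> \<inter> S" using assms by auto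
  then have "ball x \<eta> \<inter> S \<noteq> {}" by blast
  moreover have "ball x \<eta> - S \<noteq> {}" using assms by blast
  ultimately have "ball x \<eta> \<inter> frontier S \<noteq> {}"
    using connected_Int_frontier[OF connected_ball] by blast
  then show ?thesis using that by auto
qed

lemma rolling_complement_ball:
  fixes S :: "'a::euclidean_space set"
  assumes "rolling l (- S)" "a \<in> frontier S"
  obtains y where "dist y a \<le> l" "ball y l \<subseteq> S"
proof -
  obtain y where "a \<in> cball y l" "interior (cball y l) \<inter> - S = {}"
    using assms unfolding rolling_def by (auto simp: frontier_complement)
  then show ?thesis using that[of y] by auto
qed

text \<open>Away from the frontier \<open>ball s \<eta>\<close> itself lies in \<open>S\<close>;
  otherwise a ball of radius \<open>l\<close> inside \<open>S\<close> that reaches a nearby frontier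
  point provides the room. Hence a sample meeting every small ball in \<open>S\<close> is dense in
  \<open>S\<close>.\<close>

lemma rolling_complement_density:
  fixes S :: "'a::euclidean_space set"
  assumes "rolling l (- S)" "0 < l" "0 < \<delta>" "s \<in> S"
  obtains q where "cball q (min (\<delta> / 2) l / 4) \<subseteq> S \<inter> ball s \<delta>"
proof -
  \<comment> \<open>Two lengths \<open>\<eta>\<close> are spent, from \<open>s\<close> to the
    frontier point and around that point; \<open>\<eta> \<le> l\<close> is for
    \<open>cball_in_balls\<close>.\<close>
  define \<eta> where "\<eta> = min (\<delta> / 2) l"
  have \<eta>: "0 < \<eta>" "\<eta> \<le> \<delta> / 2" "\<eta> \<le> l" using assms by (auto simp: \<eta>_def)
  show ?thesis
  proof (cases "ball s \<eta> \<subseteq> S")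
    case True
    have "cball s (\<eta> / 4) \<subseteq> ball s \<eta>" "ball s \<eta> \<subseteq> ball s \<delta>" using \<eta> by auto
    then show ?thesis using that[of s] True by (auto simp: \<eta>_def)
  next
    case False
    then obtain a where a: "a \<in> frontier S" "dist s a < \<eta>" using frontier_near assms(4) by blast
    obtain y where y: "dist y a \<le> l" "ball y l \<subseteq> S"
      using rolling_complement_ball[OF assms(1) a(1)] by blast
    obtain q where q: "cball q (\<eta> / 4) \<subseteq> ball a \<eta> \<inter> ball y l"
      using cball_in_balls[OF \<eta>(1,3) y(1)] by blast
    have "ball a \<eta> \<subseteq> ball s \<delta>"
    proof
      fix p assume "p \<in> ball a \<eta>"
      then show "p \<in> ball s \<delta>" using a(2) \<eta> dist_triangle[of s p a] by auto
    qed
    then show ?thesis using that[of q] q y by (auto simp: \<eta>_def)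
  qed
qed

text \<open>A \<open>\<gamma>\<close>-ball containing \<open>x\<close> shares with
  \<open>ball x \<eta>\<close> a ball of radius \<open>\<eta> / 4\<close>, which lies in
  \<open>S\<close> and so contains a sample point.\<close>

lemma inner_parallel_subset_rhull:
  fixes S :: "'a::euclidean_space set"
  assumes "0 < \<eta>" "\<eta> \<le> \<gamma>"
    and P: "\<And>q. cball q (\<eta> / 4) \<subseteq> S \<Longrightarrow> ball q (\<eta> / 4) \<inter> P \<noteq> {}"
  shows "{x. ball x \<eta> \<subseteq> S} \<subseteq> rhull \<gamma> P"
proof
  fix x assume "x \<in> {x. ball x \<eta> \<subseteq> S}"
  then have x: "ball x \<eta> \<subseteq> S" by simp
  show "x \<in> rhull \<gamma> P"
    unfolding mem_rhull_iff
  proof safe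
    fix c assume "dist c x < \<gamma>"
    then obtain q where q: "cball q (\<eta> / 4) \<subseteq> ball x \<eta> \<inter> ball c \<gamma>"
      using cball_in_balls[OF assms(1,2), of c x] by auto
    then obtain a where a: "a \<in> P" "a \<in> ball q (\<eta> / 4)" using P[of q] x by blast
    have "a \<in> ball c \<gamma>" using q a(2) by (auto simp: subset_iff)
    then show "\<exists>a\<in>P. dist c a < \<gamma>" using a by auto
  qed
qed

section \<open>Volume of the boundary layer and nets\<close>

lemma measure_lborel_mono:
  fixes A B :: "'a::euclidean_space set"
  assumes "A \<subseteq> B" "A \<in> sets borel" "B \<in> sets borel" "bounded B"
  shows "measure lborel A \<le> measure lborel B"
  using assms emeasure_bounded_finite[of B] by (intro measure_mono_fmeasurable fmeasurableI) auto

text \<open>The translates of \<open>T\<close> by \<open>k * v\<close> for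
  \<open>k = 0, ..., K\<close> are disjoint and lie in one ball. \<open>T\<close> itself counts,
  hence \<open>K + 1\<close>.\<close>

lemma disjoint_translates_measure:
  fixes T :: "'a::euclidean_space set"
  assumes T: "T \<in> sets borel" "T \<subseteq> cball 0 R"
    and disj: "\<And>k x. 1 \<le> k \<Longrightarrow> k \<le> K \<Longrightarrow> x \<in> T \<Longrightarrow> x + real k *\<^sub>R v \<notin> T"
    and b: "real K * norm v \<le> b"
  shows "(real K + 1) * measure lborel T \<le> measure lborel (cball (0::'a) (R + b))"
proof -
  define U where "U k = (\<lambda>x. - (real k *\<^sub>R v) + x) -` T" for k
  have U: "U k \<in> sets borel" for k
    unfolding U_def by (rule measurable_sets_borel[OF _ T(1)]) simp
  have mU: "measure lborel (U k) = measure lborel T" for k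
  proof -
    have "measure lborel T = measure (distr lborel borel ((+) (- (real k *\<^sub>R v)))) T"
      by (subst lborel_distr_plus) simp
    also have "\<dots> = measure lborel (U k)"
      using T(1) by (subst measure_distr) (auto simp: U_def simp del: add_uminus_conv_diff uminus_add_conv_diff)
    finally show ?thesis by simp
  qed
  have sub: "U k \<subseteq> cball 0 (R + b)" if "k \<le> K" for k
  proof
    fix x assume "x \<in> U k"
    then have "norm (- (real k *\<^sub>R v) + x) \<le> R" using T(2) by (auto simp: U_def)
    moreover have "norm (real k *\<^sub>R v) \<le> b"
      using that b mult_right_mono[of "real k" "real K" "norm v"] by simp
    ultimately show "x \<in> cball 0 (R + b)"
      using norm_triangle_ineq2[of x "real k *\<^sub>R v"] by simp
  qed
  have finU: "emeasure lborel (U k) \<noteq> \<infinity>" if "k \<le> K" for k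
    using emeasure_bounded_finite[OF bounded_subset[OF bounded_cball sub[OF that]]] by auto
  have dis: "disjoint_family_on U {..K}"
  proof -
    have "U i \<inter> U j = {}" if "i < j" "j \<le> K" for i j
    proof (rule ccontr)
      assume "U i \<inter> U j \<noteq> {}"
      then obtain x where "- (real i *\<^sub>R v) + x \<in> T" "- (real j *\<^sub>R v) + x \<in> T" by (auto simp: U_def)
      moreover have "- (real i *\<^sub>R v) + x = (- (real j *\<^sub>R v) + x) + real (j - i) *\<^sub>R v"
        using that by (simp add: of_nat_diff algebra_simps)
      moreover have "1 \<le> j - i" "j - i \<le> K" using that by auto
      ultimately show False using disj by metis
    qed
    then show ?thesis
      unfolding disjoint_family_on_def by (metis atMost_iff inf_commute linorder_neqE_nat)
  qed
  have "(real K + 1) * measure lborel T = (\<Sum>k\<le>K. measure lborel (U k))"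
    by (simp add: mU)
  also have "\<dots> = measure lborel (\<Union>k\<le>K. U k)"
    using dis U finU by (intro measure_finite_Union[symmetric]) auto
  also have "\<dots> \<le> measure lborel (cball (0::'a) (R + b))"
    using U sub by (intro measure_lborel_mono) auto
  finally show ?thesis .
qed

lemma closed_inner_parallel:
  fixes S :: "'a::euclidean_space set"
  assumes "closed S"
  shows "closed {x. ball x \<eta> \<subseteq> S}"
proof -
  have "{x. ball x \<eta> \<subseteq> S} = (\<Inter>v\<in>ball 0 \<eta>. (\<lambda>x. x + v) -` S)"
  proof (intro set_eqI iffI)
    fix x assume "x \<in> (\<Inter>v\<in>ball 0 \<eta>. (\<lambda>x. x + v) -` S)"
    then have *: "\<And>v. norm v < \<eta> \<Longrightarrow> x + v \<in> S" by auto
    show "x \<in> {x. ball x \<eta> \<subseteq> S}"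
      using *[of "_ - x"] by (auto simp: dist_norm norm_minus_commute)
  qed (auto simp: dist_norm subset_iff)
  also have "closed \<dots>"
    using assms by (intro closed_INT ballI closed_vimage continuous_intros) auto
  finally show ?thesis .
qed

text \<open>The norm is at most the sum of the absolute coordinates, so some coordinate reaches the
  average. With finitely many directions the boundary layer splits into finitely many
  pieces.\<close>

lemma Basis_direction:
  fixes w :: "'a::euclidean_space"
  obtains e where "e \<in> Basis \<union> uminus ` Basis" "norm w / real DIM('a) \<le> w \<bullet> e"
proof -
  have "\<exists>b\<in>Basis. norm w / real DIM('a) \<le> \<bar>w \<bullet> b\<bar>"
  proof (rule ccontr)
    assume "\<not> ?thesis"
    then have "(\<Sum>b\<in>(Basis::'a set). \<bar>w \<bullet> b\<bar>) < (\<Sum>b\<in>(Basis::'a set). norm w / real DIM('a))"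
      by (intro sum_strict_mono) (auto simp: not_le)
    then show False using norm_le_l1[of w] by simp
  qed
  then obtain b where b: "b \<in> Basis" "norm w / real DIM('a) \<le> \<bar>w \<bullet> b\<bar>" by blast
  then show ?thesis
    using that[of b] that[of "- b"] by (cases "w \<bullet> b \<ge> 0") auto
qed

text \<open>Near a boundary point the outside ball leaves \<open>S\<close> along some coordinate direction \<open>e\<close>: a
  segment of length of order \<open>r\<close> starting at distance of order \<open>\<eta>\<close> from \<open>x\<close> misses \<open>S\<close>. So of
  order \<open>r / \<eta>\<close> translates along \<open>e\<close> of the corresponding part of the layer are disjoint.\<close>

lemma rolling_layer_direction:
  fixes S :: "'a::euclidean_space set"
  assumes "rolling r S" "0 < r" "closed S" "0 < \<eta>" "\<eta> \<le> r" "x \<in> S" "\<not> ball x \<eta> \<subseteq> S"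
  obtains e where "e \<in> Basis \<union> uminus ` Basis"
    "\<And>s. 3 * real DIM('a) * \<eta> \<le> s \<Longrightarrow> s \<le> r / real DIM('a) \<Longrightarrow> x + s *\<^sub>R e \<notin> S"
proof -
  obtain a where a: "a \<in> frontier S" "dist x a < \<eta>" using frontier_near assms by blast
  then obtain z where z: "a \<in> cball z r" "ball z r \<inter> S = {}"
    using assms(1) unfolding rolling_def by auto
  \<comment> \<open>\<open>z\<close> is the centre of the outside ball at \<open>a\<close>; its
    distance from \<open>x\<close> lies between \<open>r\<close> and
    \<open>r + \<eta>\<close>.\<close>
  define w where "w = z - x"
  have far: "norm w \<ge> r" using z(2) assms(6) by (auto simp: w_def disjoint_iff dist_norm intro: leI)
  have near: "norm w < r + \<eta>"
    using z(1) a(2) dist_triangle[of z x a] by (simp add: w_def dist_norm norm_minus_commute)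
  obtain e where e: "e \<in> Basis \<union> uminus ` Basis" "norm w / real DIM('a) \<le> w \<bullet> e"
    using Basis_direction .
  have ne: "e \<bullet> e = 1" using e(1) by (auto simp: inner_Basis)
  show ?thesis
  proof (rule that[OF e(1)])
    fix s assume s: "3 * real DIM('a) * \<eta> \<le> s" "s \<le> r / real DIM('a)"
    have s0: "0 < s" using s(1) assms(4) by (smt (verit) DIM_positive mult_pos_pos of_nat_0_less_iff)
    have we: "r / real DIM('a) \<le> w \<bullet> e"
      using e(2) divide_right_mono[OF far, of "real DIM('a)"] by simp
    have "(norm (x + s *\<^sub>R e - z))\<^sup>2 = (norm (s *\<^sub>R e - w))\<^sup>2" by (simp add: w_def algebra_simps)
    also have "\<dots> = (norm w)\<^sup>2 - 2 * (s * (w \<bullet> e)) + s * s"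
      by (simp add: power2_norm_eq_inner inner_diff_left inner_diff_right inner_commute ne)
    also have "\<dots> < (r + \<eta>)\<^sup>2 - 2 * (s * (r / real DIM('a))) + s * (r / real DIM('a))"
    proof -
      have "(norm w)\<^sup>2 < (r + \<eta>)\<^sup>2" using near by (intro power_strict_mono) auto
      moreover have "s * (r / real DIM('a)) \<le> s * (w \<bullet> e)" "s * s \<le> s * (r / real DIM('a))"
        using s0 we s(2) by (intro mult_left_mono; simp)+
      moreover have "A - 2 * P + T < B - 2 * Q + Q" if "A < B" "Q \<le> P" "T \<le> Q" for A B P Q T :: real
        using that by linarith
      ultimately show ?thesis by blast
    qed
    also have "\<dots> = r\<^sup>2 + (2 * r * \<eta> + \<eta> * \<eta>) - s * (r / real DIM('a))"
      by (simp add: power2_eq_square algebra_simps)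
    \<comment> \<open>The factor 3 in the lower bound on \<open>s\<close> pays for
      \<open>2 * r * \<eta>\<close> and for \<open>\<eta> * \<eta> \<le> r * \<eta>\<close>.\<close>
    also have "\<dots> \<le> r\<^sup>2"
    proof -
      have "\<eta> * \<eta> \<le> r * \<eta>" using assms by (intro mult_right_mono) auto
      moreover have "3 * real DIM('a) * \<eta> * (r / real DIM('a)) \<le> s * (r / real DIM('a))"
        using s(1) assms by (intro mult_right_mono) auto
      then have "3 * (r * \<eta>) \<le> s * (r / real DIM('a))" by (simp add: ac_simps)
      ultimately show ?thesis by linarith
    qed
    finally have "norm (x + s *\<^sub>R e - z) < r"
      using assms(2) by (simp add: power2_less_imp_less)
    then show "x + s *\<^sub>R e \<notin> S" using z(2) by (auto simp: disjoint_iff dist_norm norm_minus_commute)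
  qed
qed

text \<open>One piece of the layer is taken for each signed coordinate direction; disjoint
  translates in a fixed ball bound its volume by a multiple of \<open>\<eta>\<close>.\<close>

lemma rolling_layer_measure:
  fixes S :: "'a::euclidean_space set"
  assumes "rolling r S" "0 < r" "compact S"
  obtains C where "0 \<le> C"
    "\<And>\<eta>. 0 < \<eta> \<Longrightarrow> \<eta> \<le> r \<Longrightarrow> measure lborel S - C * \<eta> \<le> measure lborel {x. ball x \<eta> \<subseteq> S}"
proof -
  define d where "d = real DIM('a)"
  have d: "d > 0" by (simp add: d_def)
  have cl: "closed S" using assms(3) by (rule compact_imp_closed)
  obtain R where R: "S \<subseteq> cball 0 R"
    using compact_imp_bounded[OF assms(3)] that by (auto simp: bounded_iff subset_iff)
  define V where "V = measure lborel (cball (0::'a) (R + r / d))"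
  let ?E = "Basis \<union> uminus ` Basis :: 'a set"
  define C where "C = real (card ?E) * (3 * d * d * V / r)"
  have fE: "finite ?E" by simp
  show ?thesis
  proof (rule that[of C])
    show "0 \<le> C" using assms d by (simp add: C_def V_def)
    fix \<eta> :: real assume \<eta>: "0 < \<eta>" "\<eta> \<le> r"
    define h where "h = 3 * d * \<eta>"
    have h: "0 < h" using \<eta> d by (simp add: h_def)
    \<comment> \<open>Removing a compact image from \<open>S\<close> makes Borel measurability
      immediate; the fact \<open>T\<close> below gives the pointwise form.\<close>
    define T where "T e = S - (\<lambda>(y, s). y - s *\<^sub>R e) ` (S \<times> {h..r / d})" for e
    have T: "T e = {x \<in> S. \<forall>s. h \<le> s \<longrightarrow> s \<le> r / d \<longrightarrow> x + s *\<^sub>R e \<notin> S}" for e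
      by (force simp: T_def)
    have Tm: "T e \<in> sets borel" for e
    proof -
      have "compact ((\<lambda>(y, s). y - s *\<^sub>R e) ` (S \<times> {h..r / d}))"
        unfolding case_prod_unfold
        using assms(3) by (intro compact_continuous_image compact_Times continuous_intros) auto
      then show ?thesis unfolding T_def using cl by (blast intro: sets.Diff borel_closed compact_imp_closed)
    qed
    have meas: "measure lborel (T e) \<le> 3 * d * d * V / r * \<eta>" if e: "e \<in> ?E" for e
    proof -
      \<comment> \<open>The multiples \<open>h, ..., K * h\<close> stay within \<open>r / d\<close>,
        the range in which points of \<open>T e\<close> leave \<open>S\<close>. The bound
        \<open>K + 1 \<ge> r / d / h\<close> holds even when \<open>K = 0\<close>.\<close>
      define K where "K = nat \<lfloor>r / d / h\<rfloor>"
      have q0: "0 \<le> r / d / h" using assms d h by simp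
      then have K: "real K \<le> r / d / h" "r / d / h \<le> real K + 1"
        unfolding K_def by linarith+
      have Kh: "real K * h \<le> r / d" using K(1) by (simp only: pos_le_divide_eq[OF h])
      have "real K * norm (h *\<^sub>R e) \<le> r / d"
      proof -
        have "norm e = 1" using e by auto
        then show ?thesis using Kh h by simp
      qed
      then have "(real K + 1) * measure lborel (T e) \<le> V"
        unfolding V_def
      proof (intro disjoint_translates_measure)
        show "T e \<subseteq> cball 0 R" using R by (auto simp: T_def)
        fix k x assume k: "1 \<le> k" "k \<le> K" "x \<in> T e"
        have "h \<le> real k * h" using k h by simp
        moreover have "real k * h \<le> real K * h" using k h by simp
        ultimately show "x + real k *\<^sub>R h *\<^sub>R e \<notin> T e"
          using k(3) Kh by (auto simp: T)
      qed (use Tm in auto)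
      moreover have "r / d / h * measure lborel (T e) \<le> (real K + 1) * measure lborel (T e)"
        using K(2) by (intro mult_right_mono) auto
      ultimately have "r / d / h * measure lborel (T e) \<le> V" by linarith
      then show ?thesis using assms d h \<eta> by (simp add: h_def field_simps)
    qed
    have cover: "S \<subseteq> {x. ball x \<eta> \<subseteq> S} \<union> (\<Union>e\<in>?E. T e)"
    proof
      fix x assume x: "x \<in> S"
      show "x \<in> {x. ball x \<eta> \<subseteq> S} \<union> (\<Union>e\<in>?E. T e)"
      proof (cases "ball x \<eta> \<subseteq> S")
        case False
        obtain e where "e \<in> ?E" "\<And>s. h \<le> s \<Longrightarrow> s \<le> r / d \<Longrightarrow> x + s *\<^sub>R e \<notin> S"
          using rolling_layer_direction[OF assms(1,2) cl \<eta> x False] unfolding h_def d_def by blast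
        then show ?thesis using x unfolding T by blast
      qed auto
    qed
    have bI: "{x. ball x \<eta> \<subseteq> S} \<subseteq> S" using \<eta> by auto
    have bT: "(\<Union>e\<in>?E. T e) \<subseteq> S" by (auto simp: T_def)
    have fin: "A \<in> fmeasurable lborel" if "A \<subseteq> S" "A \<in> sets borel" for A
      using that emeasure_bounded_finite[OF bounded_subset[OF compact_imp_bounded[OF assms(3)]], of A]
      by (intro fmeasurableI) auto
    have mI: "{x. ball x \<eta> \<subseteq> S} \<in> sets borel" using closed_inner_parallel[OF cl] by (rule borel_closed)
    have mT: "(\<Union>e\<in>?E. T e) \<in> sets borel" using Tm fE by (intro sets.finite_UN) auto
    have "measure lborel S \<le> measure lborel ({x. ball x \<eta> \<subseteq> S} \<union> (\<Union>e\<in>?E. T e))"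
      using cover bI bT cl mI mT compact_imp_bounded[OF assms(3)]
      by (intro measure_lborel_mono sets.Un) (auto intro: bounded_subset)
    also have "\<dots> \<le> measure lborel {x. ball x \<eta> \<subseteq> S} + measure lborel (\<Union>e\<in>?E. T e)"
      using mI mT by (intro measure_Un_le) auto
    also have "measure lborel (\<Union>e\<in>?E. T e) \<le> (\<Sum>e\<in>?E. measure lborel (T e))"
      using fE Tm by (intro measure_UNION_le) auto
    also have "\<dots> \<le> (\<Sum>e\<in>?E. 3 * d * d * V / r * \<eta>)" by (intro sum_mono meas)
    also have "\<dots> = C * \<eta>" by (simp add: C_def)
    finally show "measure lborel S - C * \<eta> \<le> measure lborel {x. ball x \<eta> \<subseteq> S}" by simp
  qed
qed

text \<open>An \<open>\<epsilon>\<close>-separated subset of \<open>A\<close> of largest cardinality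
  covers \<open>A\<close>, since an uncovered point could be added. Its balls of radius
  \<open>\<epsilon> / 2\<close> are disjoint in \<open>S\<close>, which bounds the
  cardinality.\<close>

lemma separated_net:
  fixes S :: "'a::euclidean_space set"
  assumes "0 < \<epsilon>" "compact S" and sub: "\<And>a. a \<in> A \<Longrightarrow> ball a (\<epsilon> / 2) \<subseteq> S"
  obtains F where "finite F" "F \<subseteq> A" "A \<subseteq> (\<Union>f\<in>F. ball f \<epsilon>)"
    "real (card F) * measure lborel (ball (0::'a) (\<epsilon> / 2)) \<le> measure lborel S"
proof -
  define V where "V = measure lborel (ball (0::'a) (\<epsilon> / 2))"
  have V: "measure lborel (ball a (\<epsilon> / 2)) = V" for a :: 'a
    using assms(1) by (simp add: V_def content_ball)
  have Vpos: "V > 0" using assms(1) by (simp add: V_def content_ball)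
  define sep where "sep F \<longleftrightarrow> finite F \<and> F \<subseteq> A \<and> (\<forall>x\<in>F. \<forall>y\<in>F. x \<noteq> y \<longrightarrow> \<epsilon> \<le> dist x y)" for F
  have card: "real (card F) * V \<le> measure lborel S" if "sep F" for F
  proof -
    have "disjoint_family_on (\<lambda>a. ball a (\<epsilon> / 2)) F"
      unfolding disjoint_family_on_def
    proof safe
      fix x y z assume "x \<in> F" "y \<in> F" "x \<noteq> y" "z \<in> ball x (\<epsilon> / 2)" "z \<in> ball y (\<epsilon> / 2)"
      then have "\<epsilon> \<le> dist x y" "dist x z < \<epsilon> / 2" "dist y z < \<epsilon> / 2" using that by (auto simp: sep_def)
      then show "z \<in> {}" using dist_triangle[of x y z] by (simp add: dist_commute)
    qed
    then have "measure lborel (\<Union>a\<in>F. ball a (\<epsilon> / 2)) = (\<Sum>a\<in>F. measure lborel (ball a (\<epsilon> / 2)))"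
      using that emeasure_bounded_finite[OF bounded_ball]
      by (intro measure_finite_Union) (auto simp: sep_def less_top[symmetric])
    then have "real (card F) * V = measure lborel (\<Union>a\<in>F. ball a (\<epsilon> / 2))" by (simp add: V)
    also have "\<dots> \<le> measure lborel S"
      using that sub assms(2)
      by (intro measure_lborel_mono) (auto simp: sep_def compact_imp_bounded compact_imp_closed)
    finally show ?thesis .
  qed
  have "\<forall>F. sep F \<longrightarrow> card F \<le> nat \<lfloor>measure lborel S / V\<rfloor>"
  proof (intro allI impI)
    fix F assume "sep F"
    then have "real (card F) \<le> measure lborel S / V" using card Vpos by (simp add: pos_le_divide_eq)
    then show "card F \<le> nat \<lfloor>measure lborel S / V\<rfloor>" by linarith
  qed
  moreover have "sep {}" by (simp add: sep_def)
  ultimately obtain F where F: "sep F" "\<And>G. sep G \<Longrightarrow> card G \<le> card F"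
    using Lattices_Big.ex_has_greatest_nat[of sep "{}" card "Suc (nat \<lfloor>measure lborel S / V\<rfloor>)"]
    by (auto simp: less_Suc_eq_le)
  show ?thesis
  proof (rule that[of F])
    show "A \<subseteq> (\<Union>f\<in>F. ball f \<epsilon>)"
    proof
      fix a assume a: "a \<in> A"
      show "a \<in> (\<Union>f\<in>F. ball f \<epsilon>)"
      proof (rule ccontr)
        assume n: "a \<notin> (\<Union>f\<in>F. ball f \<epsilon>)"
        then have "sep (insert a F)" using F(1) a by (auto simp: sep_def not_less dist_commute)
        moreover have "a \<notin> F" using n assms(1) by auto
        ultimately show False using F(2)[of "insert a F"] F(1) by (auto simp: sep_def)
      qed
    qed
  qed (use F(1) card in \<open>auto simp: sep_def V_def\<close>)
qed

section \<open>Empty balls in a uniform sample\<close>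

lemma outer_measure_of_Un_le:
  assumes "A \<subseteq> space M" "B \<subseteq> space M"
  shows "outer_measure_of M (A \<union> B) \<le> outer_measure_of M A + outer_measure_of M B"
proof -
  obtain E where E: "E \<in> sets M" "A \<subseteq> E" "outer_measure_of M A = emeasure M E"
    using outer_measure_of_attain[OF assms(1)] by auto
  obtain F where F: "F \<in> sets M" "B \<subseteq> F" "outer_measure_of M B = emeasure M F"
    using outer_measure_of_attain[OF assms(2)] by auto
  have "outer_measure_of M (A \<union> B) \<le> outer_measure_of M (E \<union> F)"
    using E F by (intro outer_measure_of_mono) auto
  also have "\<dots> \<le> emeasure M E + emeasure M F"
    using E F by (simp add: emeasure_subadditive)
  finally show ?thesis using E F by simp
qed

lemma outer_measure_of_tendsto_0_mono:
  assumes "(\<lambda>n. outer_measure_of M (E n)) \<longlonglongrightarrow> 0" "\<forall>\<^sub>F n in sequentially. D n \<subseteq> E n"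
  shows "(\<lambda>n. outer_measure_of M (D n)) \<longlonglongrightarrow> 0"
  using assms(2)
  by (intro tendsto_sandwich[OF _ _ tendsto_const assms(1)])
     (auto elim!: eventually_mono intro: outer_measure_of_mono)

lemma outer_measure_of_tendsto_0_Un:
  assumes "(\<lambda>n. outer_measure_of M (D n)) \<longlonglongrightarrow> 0" "(\<lambda>n. outer_measure_of M (E n)) \<longlonglongrightarrow> 0"
    and "\<And>n. D n \<subseteq> space M" "\<And>n. E n \<subseteq> space M"
  shows "(\<lambda>n. outer_measure_of M (D n \<union> E n)) \<longlonglongrightarrow> 0"
proof (rule tendsto_sandwich[OF _ _ tendsto_const])
  show "(\<lambda>n. outer_measure_of M (D n) + outer_measure_of M (E n)) \<longlonglongrightarrow> 0"
    using tendsto_add[OF assms(1,2)] by simp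
qed (use assms(3,4) in \<open>auto intro!: always_eventually outer_measure_of_Un_le\<close>)

section \<open>The uniform sample and its empty balls\<close>

locale uniform_sample = prob_space M
  for M :: "'w measure" +
  fixes S :: "'a::euclidean_space set" and X :: "nat \<Rightarrow> 'w \<Rightarrow> 'a"
  assumes compact_S: "compact S"
    and measure_S: "0 < measure lborel S"
    and indep_X: "indep_vars (\<lambda>_. borel) X {1..}"
    and distr_X: "\<And>i. 1 \<le> i \<Longrightarrow> distr M borel (X i) = uniform_measure lborel S"
begin

definition sample :: "nat \<Rightarrow> 'w \<Rightarrow> 'a set" where
  "sample n \<omega> = (\<lambda>i. X i \<omega>) ` {1..n}"

text \<open>A union over uncountably many centres, therefore estimated through the outer
  measure.\<close>

definition Miss :: "nat \<Rightarrow> real \<Rightarrow> 'w set" where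
  "Miss n \<rho> = {\<omega>\<in>space M. \<exists>x. cball x \<rho> \<subseteq> S \<and> ball x \<rho> \<inter> sample n \<omega> = {}}"

lemma X_measurable: "1 \<le> i \<Longrightarrow> X i \<in> borel_measurable M"
  using indep_X unfolding indep_vars_def2 by auto

lemma prob_X_notin:
  assumes "A \<in> sets borel" "1 \<le> i"
  shows "prob (X i -` (- A) \<inter> space M) = measure lborel (S - A) / measure lborel S"
proof -
  have "prob (X i -` (- A) \<inter> space M) = measure (distr M borel (X i)) (- A)"
    using assms X_measurable by (subst measure_distr) auto
  also have "\<dots> = measure lborel (S \<inter> - A) / measure lborel S"
    unfolding distr_X[OF assms(2)]
    using assms measure_S emeasure_bounded_finite[OF compact_imp_bounded[OF compact_S]]
    by (subst measure_uniform_measure) (auto simp: measure_def less_top)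
  finally show ?thesis by (simp add: Diff_eq)
qed

text \<open>For \<open>n = 0\<close> the empty intersection would be \<open>UNIV\<close> instead of
  \<open>space M\<close>.\<close>

lemma sample_misses_eq:
  assumes "1 \<le> n"
  shows "{\<omega>\<in>space M. A \<inter> sample n \<omega> = {}} = (\<Inter>i\<in>{1..n}. X i -` (- A) \<inter> space M)"
  using assms by (auto simp: sample_def)

lemma sample_misses_event:
  assumes "1 \<le> n" "A \<in> sets borel"
  shows "{\<omega>\<in>space M. A \<inter> sample n \<omega> = {}} \<in> events"
  unfolding sample_misses_eq[OF assms(1)]
  using assms X_measurable by (intro sets.finite_INT measurable_sets[where A=borel]) auto

lemma prob_sample_misses:
  assumes "1 \<le> n" "A \<in> sets borel" "A \<subseteq> S"
  shows "prob {\<omega>\<in>space M. A \<inter> sample n \<omega> = {}}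
    \<le> exp (- real n * measure lborel A / measure lborel S)"
proof -
  let ?v = "measure lborel A / measure lborel S"
  have bS: "bounded S" using compact_S by (rule compact_imp_bounded)
  have S: "S \<in> sets borel" using compact_S by (simp add: compact_imp_closed)
  have fin: "emeasure lborel A \<noteq> \<infinity>" "emeasure lborel S \<noteq> \<infinity>"
    using emeasure_bounded_finite[of A] emeasure_bounded_finite[of S] bS bounded_subset[OF bS assms(3)] by auto
  have "prob {\<omega>\<in>space M. A \<inter> sample n \<omega> = {}} = (\<Prod>i\<in>{1..n}. prob (X i -` (- A) \<inter> space M))"
    unfolding sample_misses_eq[OF assms(1)]
    using assms by (intro indep_varsD[OF indep_X]) auto
  also have "\<dots> = (measure lborel (S - A) / measure lborel S) ^ n"
    using prob_X_notin[OF assms(2)] by simp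
  also have "measure lborel (S - A) = measure lborel S - measure lborel A"
    using assms S fin by (intro measure_Diff) auto
  also have "(measure lborel S - measure lborel A) / measure lborel S = 1 - ?v"
    using measure_S by (simp add: diff_divide_distrib)
  also have "(1 - ?v) ^ n \<le> exp (- ?v) ^ n"
  proof (intro power_mono)
    show "1 - ?v \<le> exp (- ?v)" using exp_ge_add_one_self[of "- ?v"] by simp
    show "0 \<le> 1 - ?v"
      using measure_lborel_mono[OF assms(3,2) S bS] measure_S by (simp add: pos_divide_le_eq)
  qed
  also have "\<dots> = exp (- real n * measure lborel A / measure lborel S)"
    by (simp flip: exp_of_nat_mult)
  finally show ?thesis .
qed

text \<open>The uniform law puts the points in \<open>S\<close> only almost surely, so the
  exceptional set is split off.\<close>

lemma outside_null: "outer_measure_of M {\<omega>\<in>space M. \<not> sample n \<omega> \<subseteq> S} = 0"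
proof -
  have S: "S \<in> sets borel" using compact_S by (simp add: compact_imp_closed)
  have "X i -` (- S) \<inter> space M \<in> null_sets M" if "1 \<le> i" for i
    using prob_X_notin[OF S that] measurable_sets[OF X_measurable[OF that], of "- S"] S
    by (auto simp: null_sets_def emeasure_eq_measure)
  then have "(\<Union>i\<in>{1..n}. X i -` (- S) \<inter> space M) \<in> null_sets M"
    by (intro null_sets_UN') auto
  moreover have "{\<omega>\<in>space M. \<not> sample n \<omega> \<subseteq> S} = (\<Union>i\<in>{1..n}. X i -` (- S) \<inter> space M)"
    by (auto simp: sample_def)
  ultimately show ?thesis by (auto simp: null_sets_def)
qed

lemma Miss_antimono:
  assumes "\<rho> \<le> \<rho>'"
  shows "Miss n \<rho>' \<subseteq> Miss n \<rho>"
proof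
  fix \<omega> assume "\<omega> \<in> Miss n \<rho>'"
  then obtain x where "\<omega> \<in> space M" "cball x \<rho>' \<subseteq> S" "ball x \<rho>' \<inter> sample n \<omega> = {}"
    by (auto simp: Miss_def)
  moreover have "cball x \<rho> \<subseteq> cball x \<rho>'" "ball x \<rho> \<subseteq> ball x \<rho>'" using assms by auto
  ultimately show "\<omega> \<in> Miss n \<rho>" by (fastforce simp: Miss_def)
qed

text \<open>Union bound over a \<open>\<delta> * \<rho>\<close>-net of the admissible centres: an
  empty \<open>\<rho>\<close>-ball contains the ball of radius
  \<open>(1 - \<delta>) * \<rho>\<close> around some net point. The quotient bounds the size of the
  net, the exponential the probability for one point.\<close>

lemma Miss_bound:
  assumes "0 < \<rho>" "0 < \<delta>" "\<delta> < 1" "1 \<le> n"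
  defines "\<kappa> \<equiv> unit_ball_vol (real DIM('a))"
  shows "outer_measure_of M (Miss n \<rho>) \<le>
    ennreal (measure lborel S / (\<kappa> * (\<delta> * \<rho> / 2) ^ DIM('a))
      * exp (- real n * (\<kappa> * ((1 - \<delta>) * \<rho>) ^ DIM('a)) / measure lborel S))"
proof -
  let ?v = "\<kappa> * (\<delta> * \<rho> / 2) ^ DIM('a)"
  let ?p = "exp (- real n * (\<kappa> * ((1 - \<delta>) * \<rho>) ^ DIM('a)) / measure lborel S)"
  define A where "A = {x. cball x \<rho> \<subseteq> S}"
  have \<kappa>: "\<kappa> > 0" by (simp add: \<kappa>_def)
  have \<delta>\<rho>: "0 < \<delta> * \<rho>" "\<delta> * \<rho> / 2 \<le> \<rho>" using assms by auto
  have "ball a (\<delta> * \<rho> / 2) \<subseteq> S" if "a \<in> A" for a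
  proof -
    have "ball a (\<delta> * \<rho> / 2) \<subseteq> cball a \<rho>" using \<delta>\<rho> by auto
    then show ?thesis using that by (auto simp: A_def)
  qed
  from separated_net[OF \<delta>\<rho>(1) compact_S this]
  obtain F where F: "finite F" "F \<subseteq> A" "A \<subseteq> (\<Union>f\<in>F. ball f (\<delta> * \<rho>))"
    "real (card F) * measure lborel (ball (0::'a) (\<delta> * \<rho> / 2)) \<le> measure lborel S"
    by blast
  have card: "real (card F) \<le> measure lborel S / ?v"
    using F(4) \<delta>\<rho> \<kappa> by (simp add: content_ball \<kappa>_def pos_le_divide_eq)
  define B where "B f = {\<omega>\<in>space M. ball f ((1 - \<delta>) * \<rho>) \<inter> sample n \<omega> = {}}" for f
  have B: "B f \<in> events" for f unfolding B_def using assms by (intro sample_misses_event) auto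
  have "Miss n \<rho> \<subseteq> (\<Union>f\<in>F. B f)"
  proof
    fix \<omega> assume "\<omega> \<in> Miss n \<rho>"
    then obtain x where x: "\<omega> \<in> space M" "x \<in> A" "ball x \<rho> \<inter> sample n \<omega> = {}"
      by (auto simp: Miss_def A_def)
    then obtain f where f: "f \<in> F" "dist f x < \<delta> * \<rho>" using F(3) by auto
    have "ball f ((1 - \<delta>) * \<rho>) \<subseteq> ball x \<rho>"
    proof
      fix p assume "p \<in> ball f ((1 - \<delta>) * \<rho>)"
      then show "p \<in> ball x \<rho>"
        using f(2) dist_triangle[of x p f] by (simp add: dist_commute left_diff_distrib)
    qed
    then show "\<omega> \<in> (\<Union>f\<in>F. B f)" using x f by (auto simp: B_def)
  qed
  then have "outer_measure_of M (Miss n \<rho>) \<le> outer_measure_of M (\<Union>f\<in>F. B f)"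
    by (rule outer_measure_of_mono)
  also have "\<dots> = ennreal (prob (\<Union>f\<in>F. B f))"
    using B F(1) by (simp add: sets.finite_UN emeasure_eq_measure)
  also have "prob (\<Union>f\<in>F. B f) \<le> (\<Sum>f\<in>F. prob (B f))"
    using B F(1) by (intro measure_UNION_le) auto
  also have "\<dots> \<le> (\<Sum>f\<in>F. ?p)"
  proof (rule sum_mono)
    fix f assume f: "f \<in> F"
    have "(1 - \<delta>) * \<rho> \<le> \<rho>" using assms by (simp add: mult_le_cancel_right1)
    then have "ball f ((1 - \<delta>) * \<rho>) \<subseteq> cball f \<rho>" by auto
    then have "ball f ((1 - \<delta>) * \<rho>) \<subseteq> S" using f F(2) by (auto simp: A_def)
    from prob_sample_misses[OF assms(4) _ this]
    show "prob (B f) \<le> ?p"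
      using assms unfolding B_def by (simp add: content_ball \<kappa>_def)
  qed
  also have "\<dots> = real (card F) * ?p" by simp
  also have "\<dots> \<le> measure lborel S / ?v * ?p" using card by (intro mult_right_mono) auto
  finally show ?thesis by (simp add: ennreal_leI)
qed

end

section \<open>Asymptotics of the test\<close>

lemma gumbel_quantile_at_top:
  assumes "\<alpha> \<longlonglongrightarrow> 0" "\<And>n. \<alpha> n \<in> {0<..<1}"
  shows "filterlim (\<lambda>n. gumbel_quantile (\<alpha> n)) at_top sequentially"
proof -
  have "filterlim gumbel_quantile at_top (at_right 0)"
    unfolding gumbel_quantile_def by real_asymp
  moreover have "filterlim \<alpha> (at_right 0) sequentially"
    using assms by (intro tendsto_imp_filterlim_at_right) auto
  ultimately show ?thesis by (rule filterlim_compose)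
qed

lemma ln_loglog_at_top:
  fixes a b :: real
  shows "filterlim (\<lambda>n::nat. ln (real n) + a * ln (ln (real n)) + b) at_top sequentially"
  by real_asymp

text \<open>Through this bound the hypothesis on \<open>ln (\<alpha> n) / real n\<close> controls
  the critical value.\<close>

lemma gumbel_quantile_le:
  assumes "\<alpha> \<in> {0<..<1}"
  shows "gumbel_quantile \<alpha> \<le> - ln \<alpha>"
proof -
  have "\<alpha> \<le> - ln (1 - \<alpha>)" using ln_le_minus_one[of "1 - \<alpha>"] assms by simp
  then show ?thesis using assms by (simp add: gumbel_quantile_def)
qed

lemma V_hat_eq:
  fixes P :: "'a::euclidean_space set"
  assumes "0 \<le> Delta_hat \<gamma> P"
  shows "V_hat \<gamma> P = unit_ball_vol (real DIM('a)) * Delta_hat \<gamma> P ^ DIM('a)"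
  using assms by (simp add: V_hat_def content_ball)

text \<open>A ball of radius above \<open>\<rho>\<close> in the hull and free of \<open>P\<close>
  would contain a concentric \<open>\<rho>\<close>-ball inside \<open>S\<close> that misses
  \<open>P\<close>.\<close>

lemma V_hat_le:
  fixes P S :: "'a::euclidean_space set"
  assumes "0 < \<rho>" "rhull \<gamma> P \<subseteq> S"
    and "\<And>x. cball x \<rho> \<subseteq> S \<Longrightarrow> ball x \<rho> \<inter> P \<noteq> {}"
  shows "V_hat \<gamma> P \<le> unit_ball_vol (real DIM('a)) * \<rho> ^ DIM('a)"
proof -
  define R where "R = {\<rho>. 0 < \<rho> \<and> (\<exists>x. cball x \<rho> \<subseteq> rhull \<gamma> P - P)}"
  have up: "\<sigma> \<le> \<rho>" if "\<sigma> \<in> R" for \<sigma>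
  proof (rule ccontr)
    assume "\<not> \<sigma> \<le> \<rho>"
    obtain x where x: "cball x \<sigma> \<subseteq> rhull \<gamma> P - P" using \<open>\<sigma> \<in> R\<close> by (auto simp: R_def)
    have "cball x \<rho> \<subseteq> cball x \<sigma>" using \<open>\<not> \<sigma> \<le> \<rho>\<close> by auto
    then have "cball x \<rho> \<subseteq> S" "cball x \<rho> \<inter> P = {}" using x assms(2) by blast+
    moreover have "ball x \<rho> \<subseteq> cball x \<rho>" by (rule ball_subset_cball)
    ultimately show False using assms(3)[of x] by blast
  qed
  have "0 \<le> Delta_hat \<gamma> P \<and> Delta_hat \<gamma> P \<le> \<rho>"
  proof (cases "R = {}")
    case True
    then show ?thesis using assms(1) by (simp add: Delta_hat_def R_def[symmetric])
  next
    case False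
    then obtain \<sigma> where "\<sigma> \<in> R" by auto
    then have "\<sigma> \<le> Sup R" using up by (intro cSup_upper bdd_aboveI) auto
    then have "0 \<le> Sup R" using \<open>\<sigma> \<in> R\<close> by (auto simp: R_def)
    moreover have "Sup R \<le> \<rho>" using False up by (rule cSup_least)
    ultimately show ?thesis using False by (simp add: Delta_hat_def R_def[symmetric])
  qed
  then show ?thesis by (auto simp: V_hat_eq intro!: mult_left_mono power_mono)
qed

text \<open>The bound on the hull makes the set of radii bounded above, so that its real
  \<open>Sup\<close> is an upper bound.\<close>

lemma V_hat_ge:
  fixes P :: "'a::euclidean_space set"
  assumes "0 < \<rho>" "cball x \<rho> \<subseteq> rhull \<gamma> P - P" "rhull \<gamma> P \<subseteq> cball 0 B"
  shows "unit_ball_vol (real DIM('a)) * \<rho> ^ DIM('a) \<le> V_hat \<gamma> P"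
proof -
  define R where "R = {\<rho>. 0 < \<rho> \<and> (\<exists>x. cball x \<rho> \<subseteq> rhull \<gamma> P - P)}"
  have "\<sigma> \<le> B" if \<sigma>: "\<sigma> \<in> R" for \<sigma>
  proof -
    obtain y where y: "0 < \<sigma>" "cball y \<sigma> \<subseteq> rhull \<gamma> P" using \<sigma> by (auto simp: R_def)
    then have "cball y \<sigma> \<subseteq> cball 0 B" using assms(3) by blast
    then show ?thesis using y(1) unfolding cball_subset_cball_iff by (smt (verit) zero_le_dist)
  qed
  then have "bdd_above R" by (rule bdd_aboveI)
  moreover have "\<rho> \<in> R" using assms by (auto simp: R_def)
  ultimately have "\<rho> \<le> Delta_hat \<gamma> P"
    by (auto simp: Delta_hat_def R_def[symmetric] Let_def intro: cSup_upper)
  then show ?thesis using assms(1) by (subst V_hat_eq) (auto intro!: mult_left_mono power_mono)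
qed

section \<open>Limits of empty-ball probabilities and of the test\<close>

context uniform_sample
begin

text \<open>The \<open>d\<close>-th power of the radius has order \<open>n powr (- 1/2)\<close>, so
  the net has of order \<open>sqrt n\<close> points, each with a failure probability exponentially
  small in \<open>sqrt n\<close>. The division by 4 fits
  \<open>inner_parallel_subset_rhull\<close>.\<close>

lemma coarse_Miss_tendsto_0:
  "(\<lambda>n. outer_measure_of M (Miss n (real n powr (- 1 / (2 * real DIM('a))) / 4))) \<longlonglongrightarrow> 0"
proof -
  let ?d = "DIM('a)"
  define \<eta> where "\<eta> n = real n powr (- 1 / (2 * real ?d))" for n :: nat
  define \<kappa> where "\<kappa> = unit_ball_vol (real ?d)"
  define m where "m = measure lborel S"
  \<comment> \<open>\<open>K\<close> and \<open>L\<close> come from \<open>Miss_bound\<close> with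
    \<open>\<delta> = 1/2\<close>: the packing radius is \<open>\<eta> n / 16\<close> and the empty
    balls have radius \<open>\<eta> n / 8\<close>.\<close>
  define K where "K = m * 16 ^ ?d / \<kappa>"
  define L where "L = \<kappa> / (m * 8 ^ ?d)"
  have \<kappa>: "\<kappa> > 0" by (simp add: \<kappa>_def)
  have m: "m > 0" using measure_S by (simp add: m_def)
  have L: "L > 0" using \<kappa> m by (simp add: L_def)
  have "(\<lambda>n. K * real n powr (1/2) * exp (- L * real n powr (1/2))) \<longlonglongrightarrow> 0"
    using L by real_asymp
  then have lim: "(\<lambda>n. ennreal (K * real n powr (1/2) * exp (- L * real n powr (1/2)))) \<longlonglongrightarrow> 0"
    using tendsto_ennrealI by fastforce
  have "outer_measure_of M (Miss n (\<eta> n / 4)) \<le> ennreal (K * real n powr (1/2) * exp (- L * real n powr (1/2)))"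
    if n: "1 \<le> n" for n
  proof -
    have \<eta>: "0 < \<eta> n" using n by (simp add: \<eta>_def)
    have pw: "\<eta> n ^ ?d = real n powr (- 1/2)"
      using n by (simp add: \<eta>_def powr_powr flip: powr_realpow)
    have "m / (\<kappa> * (1/2 * (\<eta> n / 4) / 2) ^ ?d) = K * real n powr (1/2)"
    proof -
      have "(1/2 * (\<eta> n / 4) / 2) ^ ?d = real n powr (- 1/2) / 16 ^ ?d"
        by (simp add: power_divide pw)
      then have "m / (\<kappa> * (1/2 * (\<eta> n / 4) / 2) ^ ?d) = m * 16 ^ ?d / (\<kappa> * real n powr (- 1/2))"
        by simp
      also have "\<dots> = K * real n powr (1/2)" using n \<kappa> by (simp add: K_def powr_minus divide_simps)
      finally show ?thesis .
    qed
    moreover have "- real n * (\<kappa> * ((1 - 1/2) * (\<eta> n / 4)) ^ ?d) / m = - L * real n powr (1/2)"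
    proof -
      have "((1 - 1/2) * (\<eta> n / 4)) ^ ?d = real n powr (- 1/2) / 8 ^ ?d"
        by (simp add: power_divide pw)
      moreover have "real n * real n powr (- 1/2) = real n powr (1/2)"
        using n powr_add[of "real n" 1 "- 1/2"] by simp
      ultimately show ?thesis by (simp add: L_def field_simps)
    qed
    ultimately show ?thesis
      using Miss_bound[of "\<eta> n / 4" "1/2" n] \<eta> n unfolding \<kappa>_def[symmetric] m_def[symmetric] by simp
  qed
  then show ?thesis
    unfolding \<eta>_def[symmetric]
    by (intro tendsto_sandwich[OF _ _ tendsto_const lim]) (auto intro: eventually_sequentiallyI)
qed

text \<open>The union bound at mesh \<open>\<rho> / ln n\<close>: the \<open>n (ln n)\<^sup>d / T\<close> balls of the net account exactly
  for the \<open>(d - 1) ln ln n\<close> in \<open>T\<close>, and the shrinking of the balls costs only a bounded factor.\<close>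

lemma fine_Miss_tendsto_0:
  fixes w \<rho> :: "nat \<Rightarrow> real"
  defines "T \<equiv> \<lambda>n. ln (real n) + (real DIM('a) - 1) * ln (ln (real n)) + w n"
  assumes w: "filterlim w at_top sequentially" "\<And>n. w n \<le> ln (real n)"
    and \<rho>: "\<forall>\<^sub>F n in sequentially. 0 < \<rho> n \<and>
      unit_ball_vol (real DIM('a)) * \<rho> n ^ DIM('a) = measure lborel S * T n / real n"
  shows "(\<lambda>n. outer_measure_of M (Miss n (\<rho> n))) \<longlonglongrightarrow> 0"
proof -
  define d where "d = DIM('a)"
  have d: "1 \<le> d" by (simp add: d_def DIM_ge_Suc0)
  define \<kappa> where "\<kappa> = unit_ball_vol (real d)"
  define m where "m = measure lborel S"
  have m: "m > 0" using measure_S by (simp add: m_def)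
  \<comment> \<open>\<open>2 ^ d\<close> comes from the halved packing radius, the exponential from
    shrinking the balls by \<open>1 - \<delta>\<close>.\<close>
  define C where "C = 2 ^ d * exp (real d * (real d + 1))"
  have "((\<lambda>x. C * exp (- x)) \<longlongrightarrow> 0) at_top"
    by real_asymp
  then have "(\<lambda>n. C * exp (- w n)) \<longlonglongrightarrow> 0"
    using w(1) by (rule filterlim_compose)
  then have lim: "(\<lambda>n. ennreal (C * exp (- w n))) \<longlonglongrightarrow> 0"
    using tendsto_ennrealI by fastforce
  have evln: "\<forall>\<^sub>F n in sequentially. exp 1 < real n"
    by real_asymp
  have evw: "\<forall>\<^sub>F n in sequentially. 0 \<le> w n"
    using w(1) by (simp add: filterlim_at_top)
  have "\<forall>\<^sub>F n in sequentially. outer_measure_of M (Miss n (\<rho> n)) \<le> ennreal (C * exp (- w n))"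
    using evln evw \<rho> eventually_ge_at_top[of 1]
  proof eventually_elim
    case (elim n)
    let ?n = "real n" and ?l = "ln (real n)" and ?T = "T n" and ?\<rho> = "\<rho> n"
    have n: "0 < ?n" using elim by simp
    have l: "1 < ?l" using elim n by (metis exp_gt_zero ln_exp ln_less_cancel_iff)
    define \<delta> where "\<delta> = 1 / ?l"
    have \<delta>: "0 < \<delta>" "\<delta> < 1" using l by (auto simp: \<delta>_def)
    have ll: "0 \<le> ln ?l" "ln ?l \<le> ?l" using l ln_le_minus_one[of ?l] by auto
    have T: "?T = ?l + (real d - 1) * ln ?l + w n" by (simp add: T_def d_def)
    have Tl: "?l \<le> ?T" using ll elim d by (simp add: T)
    have "(real d - 1) * ln ?l \<le> (real d - 1) * ?l" using ll d by (intro mult_left_mono) auto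
    \<comment> \<open>The cap on \<open>w\<close> enters here; it keeps \<open>?T * \<delta>\<close>
      bounded.\<close>
    then have "?T \<le> (real d + 1) * ?l" using w(2)[of n] unfolding T by (simp add: algebra_simps)
    then have T\<delta>: "?T * \<delta> \<le> real d + 1" using l by (simp add: \<delta>_def pos_divide_le_eq)
    have vol: "\<kappa> * ?\<rho> ^ d = m * ?T / ?n" "0 < ?\<rho>" using elim by (auto simp: \<kappa>_def d_def m_def)
    have count: "m / (\<kappa> * (\<delta> * ?\<rho> / 2) ^ d) \<le> 2 ^ d * ?n * ?l ^ (d - 1)"
    proof -
      have "\<kappa> * (\<delta> * ?\<rho> / 2) ^ d = (\<kappa> * ?\<rho> ^ d) * \<delta> ^ d / 2 ^ d"
        by (simp add: power_divide power_mult_distrib)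
      also have "\<dots> = m * ?T / (?n * ?l ^ d * 2 ^ d)"
        unfolding vol by (simp add: \<delta>_def power_divide)
      finally have "m / (\<kappa> * (\<delta> * ?\<rho> / 2) ^ d) = 2 ^ d * ?n * (?l ^ d / ?T)"
        using m by simp
      also have "?l ^ d / ?T \<le> ?l ^ d / ?l"
        using Tl l by (intro divide_left_mono) auto
      also have "?l ^ d / ?l = ?l ^ (d - 1)" using l d by (simp add: power_diff)
      finally show ?thesis by (simp add: mult_left_mono)
    qed
    \<comment> \<open>By Bernoulli's inequality, shrinking the balls costs at most
      \<open>d * ?T * \<delta>\<close> in the exponent.\<close>
    have expo: "- ?n * (\<kappa> * ((1 - \<delta>) * ?\<rho>) ^ d) / m \<le> - ?T + real d * (real d + 1)"
    proof -
      have "- ?n * (\<kappa> * ((1 - \<delta>) * ?\<rho>) ^ d) / m = - ?n * ((\<kappa> * ?\<rho> ^ d) * (1 - \<delta>) ^ d) / m"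
        by (simp add: power_mult_distrib)
      also have "\<dots> = - ?T * (1 - \<delta>) ^ d"
        unfolding vol using n m by simp
      also have "\<dots> \<le> - ?T * (1 + real d * (- \<delta>))"
        using Bernoulli_inequality[of "- \<delta>" d] \<delta> Tl l by (intro mult_left_mono_neg) auto
      also have "\<dots> = - ?T + real d * (?T * \<delta>)" by (simp add: algebra_simps)
      also have "\<dots> \<le> - ?T + real d * (real d + 1)" using T\<delta> by (simp add: mult_left_mono)
      finally show ?thesis .
    qed
    \<comment> \<open>The denominator cancels the bound in \<open>count\<close>, leaving
      \<open>exp (- w n)\<close> up to a constant.\<close>
    have eT: "exp (- ?T) = exp (- w n) / (?n * ?l ^ (d - 1))"
    proof -
      have "exp ((real d - 1) * ln ?l) = ?l ^ (d - 1)"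
        using l exp_of_nat_mult[of "d - 1" "ln ?l"] unfolding of_nat_diff[OF d] by simp
      moreover have "- ?T = - ?l + - ((real d - 1) * ln ?l) + - w n" by (simp add: T)
      ultimately show ?thesis using n by (simp only: exp_add exp_minus exp_ln) (simp add: divide_inverse)
    qed
    have "m / (\<kappa> * (\<delta> * ?\<rho> / 2) ^ d) * exp (- ?n * (\<kappa> * ((1 - \<delta>) * ?\<rho>) ^ d) / m)
        \<le> (2 ^ d * ?n * ?l ^ (d - 1)) * exp (- ?T + real d * (real d + 1))"
      using count expo l n by (intro mult_mono) auto
    also have "\<dots> = C * exp (- w n)"
      using n l unfolding exp_add eT C_def by auto
    finally show ?case
      using Miss_bound[OF vol(2) \<delta>, of n] elim
      unfolding d_def[symmetric] \<kappa>_def[symmetric] m_def[symmetric]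
      by (meson ennreal_leI order_trans)
  qed
  then show ?thesis
    by (intro tendsto_sandwich[OF _ _ tendsto_const lim]) auto
qed

text \<open>Unless the sample leaves \<open>S\<close> or misses a ball of radius
  \<open>\<eta> n / 4\<close> or \<open>\<rho> n\<close> in \<open>S\<close>, its hull lies between
  the inner parallel set and \<open>S\<close>, and the statistic stays below the critical
  value.\<close>

lemma acceptance_tendsto:
  assumes roll: "rolling r S" "0 < r"
    and \<gamma>: "0 < \<gamma>" "rhull \<gamma> S = S"
    and \<alpha>: "\<alpha> \<longlonglongrightarrow> 0" "\<And>n. \<alpha> n \<in> {0<..<1}"
  shows "(\<lambda>n. outer_measure_of M
    {\<omega>\<in>space M. c_hat n (\<alpha> n) \<gamma> (sample n \<omega>) < V_hat \<gamma> (sample n \<omega>)}) \<longlonglongrightarrow> 0"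
proof -
  let ?d = "real DIM('a)"
  define m where "m = measure lborel S"
  have m: "m > 0" using measure_S by (simp add: m_def)
  define \<kappa> where "\<kappa> = unit_ball_vol ?d"
  have \<kappa>: "\<kappa> > 0" by (simp add: \<kappa>_def)
  obtain C where C: "0 \<le> C"
    "\<And>\<eta>. 0 < \<eta> \<Longrightarrow> \<eta> \<le> r \<Longrightarrow> m - C * \<eta> \<le> measure lborel {x. ball x \<eta> \<subseteq> S}"
    using rolling_layer_measure[OF roll compact_S] unfolding m_def by blast
  define L where "L n = ln (real n) + (?d - 1) * ln (ln (real n))" for n :: nat
  define q where "q n = ln (janson_const DIM('a)) + gumbel_quantile (\<alpha> n)" for n
  define \<eta> where "\<eta> n = real n powr (- 1 / (2 * ?d))" for n :: nat
  \<comment> \<open>Half of \<open>q n\<close> covers the upper tail of the spacing; the other half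
    is kept for the volume missing from the hull. The cap is the one in
    \<open>fine_Miss_tendsto_0\<close>.\<close>
  define w where "w n = min (q n / 2) (ln (real n))" for n
  define \<rho> where "\<rho> n = root DIM('a) (m * (L n + w n) / (real n * \<kappa>))" for n
  have c_hat: "c_hat n (\<alpha> n) \<gamma> P = measure lborel (rhull \<gamma> P) * (L n + q n) / real n" for n and P :: "'a set"
    by (simp add: c_hat_def L_def q_def algebra_simps)
  have q: "filterlim q at_top sequentially"
    unfolding q_def
    by (intro filterlim_tendsto_add_at_top[OF tendsto_const] gumbel_quantile_at_top[OF \<alpha>])
  have w: "filterlim w at_top sequentially"
    unfolding filterlim_at_top
  proof
    fix Z :: real
    have "filterlim (\<lambda>n. ln (real n)) at_top sequentially" by real_asymp
    then have "\<forall>\<^sub>F n in sequentially. Z \<le> ln (real n)" by (simp add: filterlim_at_top)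
    moreover have "\<forall>\<^sub>F n in sequentially. 2 * Z \<le> q n" using q by (simp add: filterlim_at_top)
    ultimately show "\<forall>\<^sub>F n in sequentially. Z \<le> w n" by eventually_elim (simp add: w_def)
  qed
  have "\<eta> \<longlonglongrightarrow> 0" unfolding \<eta>_def by real_asymp
  then have "(\<lambda>n. C * \<eta> n) \<longlonglongrightarrow> 0" by (rule tendsto_mult_right_zero)
  then have ev1: "\<forall>\<^sub>F n in sequentially. C * \<eta> n < m / 4"
    using m by (intro order_tendstoD(2)) auto
  have "(\<lambda>n. C * (\<eta> n * L n)) \<longlonglongrightarrow> 0"
    unfolding \<eta>_def L_def by (intro tendsto_mult_right_zero) real_asymp
  then have ev2: "\<forall>\<^sub>F n in sequentially. C * (\<eta> n * L n) < m / 4"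
    using m by (intro order_tendstoD(2)) auto
  have ev3: "\<forall>\<^sub>F n in sequentially. \<eta> n < min r \<gamma>"
    using \<open>\<eta> \<longlonglongrightarrow> 0\<close> roll \<gamma> by (intro order_tendstoD(2)) auto
  have ev4: "\<forall>\<^sub>F n in sequentially. 1 \<le> q n" "\<forall>\<^sub>F n in sequentially. 1 \<le> w n"
    using q w by (simp_all add: filterlim_at_top)
  have "filterlim L at_top sequentially" unfolding L_def
    using ln_loglog_at_top[of "?d - 1" 0] by simp
  then have ev5: "\<forall>\<^sub>F n in sequentially. 0 \<le> L n"
    by (simp add: filterlim_at_top)
  have ev\<rho>: "\<forall>\<^sub>F n in sequentially. 0 < \<rho> n \<and> \<kappa> * \<rho> n ^ DIM('a) = m * (L n + w n) / real n"
    using ev4(2) ev5 eventually_ge_at_top[of 1]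
  proof eventually_elim
    case (elim n)
    have pos: "0 < m * (L n + w n) / (real n * \<kappa>)" using elim m \<kappa> by simp
    then have "\<rho> n ^ DIM('a) = m * (L n + w n) / (real n * \<kappa>)"
      unfolding \<rho>_def by (intro real_root_pow_pos) auto
    moreover have "0 < \<rho> n" unfolding \<rho>_def using pos by (intro real_root_gt_zero) auto
    ultimately show ?case using \<kappa> by simp
  qed
  have lim1: "(\<lambda>n. outer_measure_of M {\<omega>\<in>space M. \<not> sample n \<omega> \<subseteq> S}) \<longlonglongrightarrow> 0"
    by (simp add: outside_null)
  have lim2: "(\<lambda>n. outer_measure_of M (Miss n (\<eta> n / 4))) \<longlonglongrightarrow> 0"
    unfolding \<eta>_def by (rule coarse_Miss_tendsto_0)
  have lim3: "(\<lambda>n. outer_measure_of M (Miss n (\<rho> n))) \<longlonglongrightarrow> 0"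
    using ev\<rho> w by (intro fine_Miss_tendsto_0[of w]) (auto simp: w_def L_def \<kappa>_def m_def)
  have "(\<lambda>n. outer_measure_of M
      ({\<omega>\<in>space M. \<not> sample n \<omega> \<subseteq> S} \<union> (Miss n (\<eta> n / 4) \<union> Miss n (\<rho> n)))) \<longlonglongrightarrow> 0"
    by (intro outer_measure_of_tendsto_0_Un lim1 lim2 lim3) (auto simp: Miss_def)
  then show ?thesis
  proof (rule outer_measure_of_tendsto_0_mono)
    show "\<forall>\<^sub>F n in sequentially.
      {\<omega>\<in>space M. c_hat n (\<alpha> n) \<gamma> (sample n \<omega>) < V_hat \<gamma> (sample n \<omega>)}
      \<subseteq> {\<omega>\<in>space M. \<not> sample n \<omega> \<subseteq> S} \<union> (Miss n (\<eta> n / 4) \<union> Miss n (\<rho> n))"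
      using ev1 ev2 ev3 ev4 ev5 ev\<rho> eventually_ge_at_top[of 1]
    proof eventually_elim
      case (elim n)
      have \<eta>: "0 < \<eta> n" "\<eta> n \<le> r" "\<eta> n \<le> \<gamma>" using elim by (auto simp: \<eta>_def)
      show ?case
      proof (rule subsetI, rule ccontr)
        fix \<omega>
        assume \<omega>: "\<omega> \<in> {\<omega>\<in>space M. c_hat n (\<alpha> n) \<gamma> (sample n \<omega>) < V_hat \<gamma> (sample n \<omega>)}"
          and n: "\<omega> \<notin> {\<omega>\<in>space M. \<not> sample n \<omega> \<subseteq> S} \<union> (Miss n (\<eta> n / 4) \<union> Miss n (\<rho> n))"
        let ?P = "sample n \<omega>"
        have P: "?P \<subseteq> S" "\<And>x. cball x (\<eta> n / 4) \<subseteq> S \<Longrightarrow> ball x (\<eta> n / 4) \<inter> ?P \<noteq> {}"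
          "\<And>x. cball x (\<rho> n) \<subseteq> S \<Longrightarrow> ball x (\<rho> n) \<inter> ?P \<noteq> {}"
          using \<omega> n by (auto simp: Miss_def)
        have hull: "rhull \<gamma> ?P \<subseteq> S" using rhull_mono[OF P(1), of \<gamma>] \<gamma>(2) by simp
        have "m - C * \<eta> n \<le> measure lborel {x. ball x (\<eta> n) \<subseteq> S}" using C(2) \<eta> by blast
        also have "\<dots> \<le> measure lborel (rhull \<gamma> ?P)"
        proof (rule measure_lborel_mono)
          show "{x. ball x (\<eta> n) \<subseteq> S} \<subseteq> rhull \<gamma> ?P"
            using \<eta> P(2) by (intro inner_parallel_subset_rhull) auto
          show "bounded (rhull \<gamma> ?P)"
            using hull compact_S by (meson bounded_subset compact_imp_bounded)
        qed (intro borel_closed closed_rhull closed_inner_parallel compact_imp_closed compact_S)+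
        finally have mh: "m - C * \<eta> n \<le> measure lborel (rhull \<gamma> ?P)" .
        have "V_hat \<gamma> ?P \<le> \<kappa> * \<rho> n ^ DIM('a)"
          unfolding \<kappa>_def using elim P(3) hull by (intro V_hat_le) auto
        also have "\<dots> = m * (L n + w n) / real n" using elim by simp
        also have "\<dots> \<le> (m - C * \<eta> n) * (L n + q n) / real n"
        \<comment> \<open>The claim is
          \<open>C * \<eta> n * (L n + q n) \<le> m * (q n - w n)\<close>. The right side is at
          least \<open>m * q n / 2\<close>, and both terms on the left are at most
          \<open>m * q n / 4\<close> since \<open>1 \<le> q n\<close>.\<close>
        proof (rule divide_right_mono)
          have "m * w n \<le> m * (q n / 2)" using m by (intro mult_left_mono) (auto simp: w_def)
          moreover have "C * \<eta> n * q n \<le> m / 4 * q n"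
            using elim by (intro mult_right_mono) auto
          moreover have "m * 1 \<le> m * q n" using m elim by (intro mult_left_mono) auto
          ultimately show "m * (L n + w n) \<le> (m - C * \<eta> n) * (L n + q n)"
            using elim(2) by (simp add: algebra_simps)
        qed simp
        also have "\<dots> \<le> measure lborel (rhull \<gamma> ?P) * (L n + q n) / real n"
          using mh elim by (intro divide_right_mono mult_right_mono) auto
        finally show False using \<omega> by (simp add: c_hat)
      qed
    qed
  qed
qed

text \<open>All radii \<open>g \<ge> \<gamma>'\<close> are handled at once: the hulls grow with the
  radius, so they share the ball around \<open>x\<close>, and they all stay in
  \<open>cball 0 B\<close>, which bounds their volumes.\<close>

lemma rejection_tendsto:
  assumes roll: "rolling l (- S)" "0 < l"
    and \<gamma>: "0 < \<gamma>" "rhull \<gamma> S \<noteq> S" "\<gamma> < \<gamma>'"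
    and \<alpha>: "\<alpha> \<longlonglongrightarrow> 0" "\<And>n. \<alpha> n \<in> {0<..<1}" "(\<lambda>n. ln (\<alpha> n) / real n) \<longlonglongrightarrow> 0"
  shows "(\<lambda>n. outer_measure_of M
    {\<omega>\<in>space M. \<exists>g\<ge>\<gamma>'. V_hat g (sample n \<omega>) \<le> c_hat n (\<alpha> n) g (sample n \<omega>)}) \<longlonglongrightarrow> 0"
proof -
  let ?d = "real DIM('a)"
  define \<kappa> where "\<kappa> = unit_ball_vol ?d"
  have \<kappa>: "\<kappa> > 0" by (simp add: \<kappa>_def)
  obtain x where x: "x \<in> rhull \<gamma> S" "x \<notin> S" using \<gamma>(2) subset_rhull[of S \<gamma>] by auto
  obtain \<rho> \<delta> where \<rho>: "\<rho> > 0" "\<delta> > 0" "cball x \<rho> \<inter> S = {}"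
    and stable: "\<And>P. (\<And>s. s \<in> S \<Longrightarrow> ball s \<delta> \<inter> P \<noteq> {}) \<Longrightarrow> cball x \<rho> \<subseteq> rhull \<gamma>' P"
    using rhull_stable[OF compact_imp_closed[OF compact_S] x \<gamma>(1,3)] by blast
  obtain B where B: "0 \<le> B" "S \<subseteq> cball 0 B"
    using compact_imp_bounded[OF compact_S] unfolding bounded_pos by (auto simp: subset_iff intro: less_imp_le)
  define V where "V = measure lborel (cball (0::'a) B)"
  \<comment> \<open>The radius that \<open>rolling_complement_density\<close> attaches to
    \<open>\<delta>\<close>; once \<open>\<eta> n / 4\<close> is below it, no ball of radius
    \<open>\<tau>\<close> in \<open>S\<close> is missed outside the coarse event.\<close>
  define \<tau> where "\<tau> = min (\<delta> / 2) l / 4"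
  have \<tau>: "\<tau> > 0" using \<rho> roll by (simp add: \<tau>_def)
  define L where "L n = ln (real n) + (?d - 1) * ln (ln (real n)) + ln (janson_const DIM('a))" for n :: nat
  define \<eta> where "\<eta> n = real n powr (- 1 / (2 * ?d))" for n :: nat
  have c_hat: "c_hat n (\<alpha> n) g P = measure lborel (rhull g P) * (gumbel_quantile (\<alpha> n) + L n) / real n"
    for n g and P :: "'a set"
    by (simp add: c_hat_def L_def algebra_simps)
  have "\<eta> \<longlonglongrightarrow> 0" unfolding \<eta>_def by real_asymp
  then have ev1: "\<forall>\<^sub>F n in sequentially. \<eta> n < 4 * \<tau>"
    using \<tau> by (intro order_tendstoD(2)) auto
  have "(\<lambda>n. L n / real n) \<longlonglongrightarrow> 0" unfolding L_def by real_asymp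
  then have "(\<lambda>n. V * (L n / real n - ln (\<alpha> n) / real n)) \<longlonglongrightarrow> V * (0 - 0)"
    using \<alpha>(3) by (intro tendsto_intros)
  then have ev2: "\<forall>\<^sub>F n in sequentially. V * (L n / real n - ln (\<alpha> n) / real n) < \<kappa> * \<rho> ^ DIM('a)"
    using \<kappa> \<rho> by (intro order_tendstoD(2)) auto
  \<comment> \<open>Nonnegativity of the factor is required when the hull volume is replaced by its
    upper bound \<open>V\<close>.\<close>
  have ev3: "\<forall>\<^sub>F n in sequentially. 0 \<le> L n"
    using ln_loglog_at_top[of "?d - 1" "ln (janson_const DIM('a))"] by (simp add: L_def filterlim_at_top)
  have ev4: "\<forall>\<^sub>F n in sequentially. 0 \<le> gumbel_quantile (\<alpha> n)"
    using gumbel_quantile_at_top[OF \<alpha>(1,2)] by (simp add: filterlim_at_top)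
  have lim1: "(\<lambda>n. outer_measure_of M {\<omega>\<in>space M. \<not> sample n \<omega> \<subseteq> S}) \<longlonglongrightarrow> 0"
    by (simp add: outside_null)
  have lim2: "(\<lambda>n. outer_measure_of M (Miss n (\<eta> n / 4))) \<longlonglongrightarrow> 0"
    unfolding \<eta>_def by (rule coarse_Miss_tendsto_0)
  have "(\<lambda>n. outer_measure_of M
      ({\<omega>\<in>space M. \<not> sample n \<omega> \<subseteq> S} \<union> Miss n (\<eta> n / 4))) \<longlonglongrightarrow> 0"
    by (intro outer_measure_of_tendsto_0_Un lim1 lim2) (auto simp: Miss_def)
  then show ?thesis
  proof (rule outer_measure_of_tendsto_0_mono)
    show "\<forall>\<^sub>F n in sequentially.
      {\<omega>\<in>space M. \<exists>g\<ge>\<gamma>'. V_hat g (sample n \<omega>) \<le> c_hat n (\<alpha> n) g (sample n \<omega>)}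
      \<subseteq> {\<omega>\<in>space M. \<not> sample n \<omega> \<subseteq> S} \<union> Miss n (\<eta> n / 4)"
      using ev1 ev2 ev3 ev4 eventually_ge_at_top[of 1]
    proof eventually_elim
      case (elim n)
      show ?case
      proof (rule subsetI, rule ccontr)
        fix \<omega>
        assume \<omega>: "\<omega> \<in> {\<omega>\<in>space M. \<exists>g\<ge>\<gamma>'. V_hat g (sample n \<omega>) \<le> c_hat n (\<alpha> n) g (sample n \<omega>)}"
          and n: "\<omega> \<notin> {\<omega>\<in>space M. \<not> sample n \<omega> \<subseteq> S} \<union> Miss n (\<eta> n / 4)"
        let ?P = "sample n \<omega>"
        have "\<omega> \<notin> Miss n \<tau>" using n Miss_antimono[of "\<eta> n / 4" \<tau> n] elim by auto
        then have P: "?P \<subseteq> S" "\<And>q. cball q \<tau> \<subseteq> S \<Longrightarrow> ball q \<tau> \<inter> ?P \<noteq> {}"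
          using \<omega> n by (auto simp: Miss_def)
        obtain g where g: "\<gamma>' \<le> g" "V_hat g ?P \<le> c_hat n (\<alpha> n) g ?P" using \<omega> by auto
        have "ball s \<delta> \<inter> ?P \<noteq> {}" if s: "s \<in> S" for s
        proof -
          obtain q where q: "cball q \<tau> \<subseteq> S \<inter> ball s \<delta>"
            using rolling_complement_density[OF roll \<rho>(2) s] unfolding \<tau>_def by blast
          then have "ball q \<tau> \<subseteq> ball s \<delta>" using ball_subset_cball[of q \<tau>] by blast
          then show ?thesis using P(2)[of q] q by blast
        qed
        then have "cball x \<rho> \<subseteq> rhull \<gamma>' ?P" by (rule stable)
        also have "\<dots> \<subseteq> rhull g ?P" using g \<gamma> by (intro rhull_radius_mono) auto
        finally have sub: "cball x \<rho> \<subseteq> rhull g ?P - ?P" using \<rho>(3) P(1) by blast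
        have hull: "rhull g ?P \<subseteq> cball 0 B"
          using B P(1) g \<gamma> by (intro rhull_subset_cball) auto
        have "\<kappa> * \<rho> ^ DIM('a) \<le> V_hat g ?P"
          unfolding \<kappa>_def using \<rho>(1) sub hull by (rule V_hat_ge)
        also have "\<dots> \<le> measure lborel (rhull g ?P) * (gumbel_quantile (\<alpha> n) + L n) / real n"
          using g(2) by (simp add: c_hat)
        also have "\<dots> \<le> V * (- ln (\<alpha> n) + L n) / real n"
        proof (intro divide_right_mono mult_mono)
          show "measure lborel (rhull g ?P) \<le> V"
            unfolding V_def using hull by (intro measure_lborel_mono) (auto intro: borel_closed closed_rhull)
        qed (use gumbel_quantile_le[OF \<alpha>(2)[of n]] elim in \<open>auto simp: V_def\<close>)
        also have "\<dots> = V * (L n / real n - ln (\<alpha> n) / real n)" by (simp add: diff_divide_distrib algebra_simps)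
        finally show False using elim by simp
      qed
    qed
  qed
qed

end

section \<open>From the two limits of the test to the estimator\<close>

theorem theorem4p1:
  fixes S :: "'a::euclidean_space set"
    and M :: "'w measure"
    and X :: "nat \<Rightarrow> 'w \<Rightarrow> 'a"
    and \<alpha> :: "nat \<Rightarrow> real"
    and r l :: real
  assumes "compact S" and "\<not> convex S" and "S \<noteq> {}"
    and "r > 0" and "l > 0"
    and "rolling r S" and "rolling l (- S)"
    and "prob_space M"
    and "prob_space.indep_vars M (\<lambda>_. borel) X {1..}"
    and "\<And>i. i \<ge> 1 \<Longrightarrow> distr M borel (X i) = uniform_measure lborel S"
    and "\<And>n. \<alpha> n \<in> {0<..<1}"
    and "\<alpha> \<longlonglongrightarrow> 0"
    and "(\<lambda>n. ln (\<alpha> n) / real n) \<longlonglongrightarrow> 0"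
  shows "converges_in_probability M
           (\<lambda>n \<omega>. r_zero_hat n (\<alpha> n) ((\<lambda>i. X i \<omega>) ` {1..n})) (r_zero S)"
proof -
  \<comment> \<open>A frontier point exists, and the ball of radius \<open>l\<close> inside
    \<open>S\<close> reaching it gives \<open>S\<close> nonempty interior and positive
    volume.\<close>
  have "S \<noteq> UNIV" using assms(1) not_bounded_UNIV compact_imp_bounded by blast
  then have "frontier S \<noteq> {}" using assms(3) by (simp add: frontier_eq_empty)
  then obtain a where "a \<in> frontier S" by auto
  then obtain y where y: "ball y l \<subseteq> S" using rolling_complement_ball[OF assms(7)] by blast
  have int: "interior S \<noteq> {}"
    using interior_maximal[OF y open_ball] assms(5) by force
  have "0 < measure lborel (ball y l)" using assms(5) by (simp add: content_ball)
  also have "\<dots> \<le> measure lborel S"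
    using y assms(1) by (intro measure_lborel_mono) (auto intro: compact_imp_bounded compact_imp_closed borel_closed)
  finally have pos: "0 < measure lborel S" .
  interpret prob_space M by fact
  interpret uniform_sample M S X
    by unfold_locales (use assms pos in auto)
  obtain \<gamma>0 where \<gamma>0: "\<gamma>0 > 0" "\<And>\<gamma>. \<gamma> \<ge> \<gamma>0 \<Longrightarrow> rhull \<gamma> S \<noteq> S"
    using rhull_large_radius[OF assms(1) int assms(2)] by blast
  let ?G = "{\<gamma>. 0 < \<gamma> \<and> rhull \<gamma> S = S}"
  have r0: "r_zero S = (SUP g\<in>insert 0 ?G. ereal g)" by (simp add: r_zero_def sup_nonneg_def)
  have "0 \<le> r_zero S" unfolding r0 by (rule SUP_upper2[of 0]) auto
  moreover have "r_zero S \<le> ereal \<gamma>0"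
    unfolding r0 using \<gamma>0 by (intro SUP_least) (force intro: leI)
  ultimately obtain r0 where r0': "r_zero S = ereal r0" "0 \<le> r0"
    by (cases "r_zero S") auto
  have large: "rhull \<gamma> S \<noteq> S" if "r0 < \<gamma>" for \<gamma>
  proof
    assume "rhull \<gamma> S = S"
    then have "ereal \<gamma> \<le> r_zero S" unfolding r0 using that r0'(2) by (intro SUP_upper) auto
    then show False using that r0' by simp
  qed
  let ?P = "\<lambda>n \<omega>. (\<lambda>i. X i \<omega>) ` {1..n}"
  show ?thesis
    unfolding converges_in_probability_def r0'(1)
  proof (intro allI impI)
    fix \<epsilon> :: real assume \<epsilon>: "0 < \<epsilon>"
    define U where "U n = {\<omega>\<in>space M. \<exists>g\<ge>r0 + \<epsilon>. V_hat g (?P n \<omega>) \<le> c_hat n (\<alpha> n) g (?P n \<omega>)}" for n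
    \<comment> \<open>\<open>r0 + \<epsilon> / 2\<close> leaves the strict gap between radii that
      \<open>rejection_tendsto\<close> requires.\<close>
    have U: "(\<lambda>n. outer_measure_of M (U n)) \<longlonglongrightarrow> 0"
      using rejection_tendsto[OF assms(7,5) _ large[of "r0 + \<epsilon> / 2"] _ assms(12,11,13), of "r0 + \<epsilon>"] \<epsilon> r0'(2)
      unfolding U_def sample_def by auto
    \<comment> \<open>Acceptance of a single radius \<open>g\<close> above
      \<open>r0 - \<epsilon>\<close> bounds the estimator below. If \<open>g = 0\<close>, the bound
      comes from the \<open>0\<close> inserted in \<open>sup_nonneg\<close>, and \<open>D n\<close>
      is empty.\<close>
    have "ereal (r0 - \<epsilon>) < (SUP g\<in>insert 0 ?G. ereal g)" using \<epsilon> unfolding r0[symmetric] r0'(1) by simp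
    then obtain g where g: "g \<in> insert 0 ?G" "r0 - \<epsilon> < g"
      unfolding less_SUP_iff using less_ereal.simps(1) by blast
    define D where "D n = (if g = 0 then {} else
      {\<omega>\<in>space M. c_hat n (\<alpha> n) g (?P n \<omega>) < V_hat g (?P n \<omega>)})" for n
    have D: "(\<lambda>n. outer_measure_of M (D n)) \<longlonglongrightarrow> 0"
    proof (cases "g = 0")
      case False
      then show ?thesis
        using acceptance_tendsto[OF assms(6,4) _ _ assms(12,11), of g] g
        unfolding D_def sample_def by auto
    qed (simp add: D_def)
    have "(\<lambda>n. outer_measure_of M (U n \<union> D n)) \<longlonglongrightarrow> 0"
      by (intro outer_measure_of_tendsto_0_Un U D) (auto simp: U_def D_def)
    then show "(\<lambda>n. outer_measure_of M
      {\<omega>\<in>space M. ereal \<epsilon> < \<bar>r_zero_hat n (\<alpha> n) (?P n \<omega>) - ereal r0\<bar>}) \<longlonglongrightarrow> 0"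
    proof (rule outer_measure_of_tendsto_0_mono, intro always_eventually allI subsetI)
      fix n \<omega>
      let ?Y = "r_zero_hat n (\<alpha> n) (?P n \<omega>)"
      assume \<omega>: "\<omega> \<in> {\<omega>\<in>space M. ereal \<epsilon> < \<bar>r_zero_hat n (\<alpha> n) (?P n \<omega>) - ereal r0\<bar>}"
      show "\<omega> \<in> U n \<union> D n"
      proof (rule ccontr)
        assume n: "\<omega> \<notin> U n \<union> D n"
        have Y: "?Y = (SUP \<gamma>\<in>insert 0 {\<gamma>. 0 < \<gamma> \<and> V_hat \<gamma> (?P n \<omega>) \<le> c_hat n (\<alpha> n) \<gamma> (?P n \<omega>)}. ereal \<gamma>)"
          by (simp add: r_zero_hat_def sup_nonneg_def)
        have "?Y \<le> ereal (r0 + \<epsilon>)"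
          unfolding Y using n \<omega> \<epsilon> r0'(2) by (intro SUP_least) (force simp: U_def intro: leI)
        moreover have "ereal g \<le> ?Y"
          unfolding Y using n \<omega> g(1) by (intro SUP_upper) (auto simp: D_def split: if_splits)
        ultimately have "\<bar>?Y - ereal r0\<bar> \<le> ereal \<epsilon>"
          using g(2) by (cases ?Y) auto
        then show False using \<omega> by auto
      qed
    qed
  qed
qed

end
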